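(* Let $n,p$ be positive integers. For any $\mathcal{A},\mathcal{B}\in\mathbb{H}^{n\times n\times p}_{++}$, the geometric mean $\mathcal{A}\#\mathcal{B}$ is the midpoint of the (unique up to parametrization) geodesic from $\mathcal{A}$ to $\mathcal{B}$ in the Riemannian manifold $(\mathbb{H}^{n\times n\times p}_{++},g)$.
   Context: A tensor $\mathcal{A}\in\mathbb{C}^{m\times n\times p}$ has frontal slices $A^{(1)},\dots,A^{(p)}\in\mathbb{C}^{m\times n}$. $\operatorname{bcirc}(\mathcal{A})\in\mathbb{C}^{mp\times np}$ is the block circulant matrix whose $(j,l)$ block is $A^{(((j-l)\bmod p)+1)}$ (first block column $A^{(1)},\dots,A^{(p)}$); $\operatorname{unfold}(\mathcal{A})$ is the block column $A^{(1)},\dots,A^{(p)}$, and $\operatorname{fold}$ is its inverse. The T-product is $\mathcal{A}*\mathcal{B}=\operatorname{fold}(\operatorname{bcirc}(\mathcal{A})\cdot\operatorname{unfold}(\mathcal{B}))$; inverses are with respect to $*$ and the identity tensor $\mathcal{I}_{n,p}$ (first frontal slice $I_n$, others zero). The T-conjugate transpose $\mathcal{A}^H$ has frontal slices $(A^{(1)})^H,(A^{(p)})^H,\dots,(A^{(2)})^H$. $\mathbb{H}^{n\times n\times p}$ is the real vector space of T-Hermitian tensors ($\mathcal{A}\in\mathbb{C}^{n\times n\times p}$, $\mathcal{A}^H=\mathcal{A}$). With $\langle\mathcal{A},\mathcal{B}\rangle=\sum_{i,j,k}\overline{a_{ijk}}b_{ijk}$, $\mathbb{H}^{n\times n\times p}_{++}$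 is the set of T-positive definite tensors, i.e. $\mathcal{A}\in\mathbb{H}^{n\times n\times p}$ with $\langle\mathcal{X},\mathcal{A}*\mathcal{X}\rangle>0$ for all nonzero $\mathcal{X}\in\mathbb{C}^{n\times1\times p}$ (equivalently, $\operatorname{bcirc}(\mathcal{A})$ is Hermitian positive definite). It is an open convex cone in $\mathbb{H}^{n\times n\times p}$ (topology of the Frobenius norm), hence a smooth manifold with $T_{\mathcal{P}}\mathbb{H}^{n\times n\times p}_{++}=\mathbb{H}^{n\times n\times p}$. The trace is $\operatorname{tr}(\mathcal{A})=\operatorname{tr}(\operatorname{bcirc}(\mathcal{A}))$, and the Riemannian metric $g$ is $g_{\mathcal{P}}(\mathcal{X},\mathcal{Y})=\operatorname{tr}(\mathcal{P}^{-1}*\mathcal{X}*\mathcal{P}^{-1}*\mathcal{Y})$. Each $\mathcal{A}\in\mathbb{H}^{n\times n\times p}_{++}$ is invertible and has a unique T-positive definite square root $\mathcal{A}^{1/2}$; $\mathcal{A}^{-1/2}=(\mathcal{A}^{1/2})^{-1}$. The geometric mean is $\mathcal{A}\#\mathcal{B}=\mathcal{A}^{1/2}*(\mathcal{A}^{-1/2}*\mathcal{B}*\mathcal{A}^{-1/2})^{1/2}*\mathcal{A}^{1/2}$. *)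

theory Defs
  imports "HOL-Analysis.Analysis"
begin

section \<open>Third-order tensors and the T-product\<close>

text \<open>
  \<open>\<A> $ k\<close> is a frontal slice of \<open>\<A>\<close>, a matrix with rows \<open>'m\<close> and columns \<open>'n\<close>.
  The finite linear order \<open>'p\<close> plays the role of \<open>1 < \<dots> < p\<close> with \<open>p = CARD('p)\<close>.
\<close>

type_synonym ('m, 'n, 'p) tensor = "complex^'n^'m^'p"

text \<open>Slice positions are counted from 0 and read modulo \<open>p\<close>, so \<open>\<A> $ slice_at i\<close> is the
  frontal slice with 1-based number \<open>(i mod p) + 1\<close>.\<close>

definition slice_pos :: "'p::{finite,linorder} \<Rightarrow> int" where
  "slice_pos k = int (card {..<k})"

definition slice_at :: "int \<Rightarrow> 'p::{finite,linorder}" where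
  "slice_at i = sorted_list_of_set UNIV ! nat (i mod int CARD('p))"

definition bcirc :: "('m::finite, 'n::finite, 'p::{finite,linorder}) tensor \<Rightarrow> complex^('p \<times> 'n)^('p \<times> 'm)" where
  "bcirc \<A> = (\<chi> r c. \<A> $ slice_at (slice_pos (fst r) - slice_pos (fst c)) $ snd r $ snd c)"

definition t_unfold :: "('m::finite, 'n::finite, 'p::finite) tensor \<Rightarrow> complex^'n^('p \<times> 'm)" where
  "t_unfold \<A> = (\<chi> r j. \<A> $ fst r $ snd r $ j)"

definition t_fold :: "complex^'n^('p \<times> 'm) \<Rightarrow> ('m::finite, 'n::finite, 'p::finite) tensor" where
  "t_fold M = (\<chi> k i j. M $ (k, i) $ j)"

definition t_prod :: "('m::finite, 'n::finite, 'p::{finite,linorder}) tensor \<Rightarrow> ('n, 's::finite, 'p) tensor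
    \<Rightarrow> ('m, 's, 'p) tensor" (infixl "\<star>" 70) where
  "\<A> \<star> \<B> = t_fold (bcirc \<A> ** t_unfold \<B>)"

definition t_id :: "('n::finite, 'n, 'p::{finite,linorder}) tensor" where
  "t_id = (\<chi> k. if k = slice_at 0 then mat 1 else 0)"

definition t_inv :: "('n::finite, 'n, 'p::{finite,linorder}) tensor \<Rightarrow> ('n, 'n, 'p) tensor" where
  "t_inv \<A> = (THE \<B>. \<A> \<star> \<B> = t_id \<and> \<B> \<star> \<A> = t_id)"

definition t_adjoint :: "('m::finite, 'n::finite, 'p::{finite,linorder}) tensor \<Rightarrow> ('n, 'm, 'p) tensor" where
  "t_adjoint \<A> = (\<chi> k i j. cnj (\<A> $ slice_at (- slice_pos k) $ j $ i))"

definition t_inner :: "('m::finite, 'n::finite, 'p::finite) tensor \<Rightarrow> ('m, 'n, 'p) tensor \<Rightarrow> complex" where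
  "t_inner \<A> \<B> = (\<Sum>i\<in>UNIV. \<Sum>j\<in>UNIV. \<Sum>k\<in>UNIV. cnj (\<A> $ k $ i $ j) * \<B> $ k $ i $ j)"

definition t_trace :: "('n::finite, 'n, 'p::{finite,linorder}) tensor \<Rightarrow> complex" where
  "t_trace \<A> = trace (bcirc \<A>)"


section \<open>T-Hermitian and T-positive definite tensors\<close>

definition t_herm :: "('n::finite, 'n, 'p::{finite,linorder}) tensor set" where
  "t_herm = {\<A>. t_adjoint \<A> = \<A>}"

definition t_pd :: "('n::finite, 'n, 'p::{finite,linorder}) tensor set" where
  "t_pd = {\<A> \<in> t_herm. \<forall>\<X> :: ('n, 1, 'p) tensor. \<X> \<noteq> 0 \<longrightarrow>
     t_inner \<X> (\<A> \<star> \<X>) \<in> \<real> \<and> 0 < Re (t_inner \<X> (\<A> \<star> \<X>))}"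

definition t_sqrt :: "('n::finite, 'n, 'p::{finite,linorder}) tensor \<Rightarrow> ('n, 'n, 'p) tensor" where
  "t_sqrt \<A> = (THE \<B>. \<B> \<in> t_pd \<and> \<B> \<star> \<B> = \<A>)"

definition t_gmean :: "('n::finite, 'n, 'p::{finite,linorder}) tensor \<Rightarrow> ('n, 'n, 'p) tensor \<Rightarrow> ('n, 'n, 'p) tensor"
    (infixl "\<sharp>" 70) where
  "\<A> \<sharp> \<B> = t_sqrt \<A> \<star> t_sqrt (t_inv (t_sqrt \<A>) \<star> \<B> \<star> t_inv (t_sqrt \<A>)) \<star> t_sqrt \<A>"

text \<open>For T-Hermitian \<open>\<X>\<close>, \<open>\<Y>\<close> and T-positive definite \<open>\<P>\<close> the trace below is real.\<close>

definition t_metric :: "('n::finite, 'n, 'p::{finite,linorder}) tensor \<Rightarrow> ('n, 'n, 'p) tensor \<Rightarrow> ('n, 'n, 'p) tensor \<Rightarrow> real" where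
  "t_metric \<P> \<X> \<Y> = Re (t_trace (t_inv \<P> \<star> \<X> \<star> t_inv \<P> \<star> \<Y>))"


section \<open>Geodesics of an open subset of a linear subspace\<close>

text \<open>
  Let \<open>U\<close> be a relatively open subset of a finite-dimensional linear subspace \<open>V\<close>, so that every
  tangent space of \<open>U\<close> is \<open>V\<close>, and let \<open>g\<close> be a Riemannian metric on \<open>U\<close>.  Every affine connection on
  \<open>U\<close> has the form \<open>\<nabla>\<^sub>X Y = DY[X] + \<Gamma>(X, Y)\<close> with \<open>\<Gamma>\<^sub>P\<close> bilinear on \<open>V\<close>.  It is torsion-free iff \<open>\<Gamma>\<^sub>P\<close> is
  symmetric, and it is compatible with \<open>g\<close> iff \<open>Z g(X, Y) = g(\<nabla>\<^sub>Z X, Y) + g(X, \<nabla>\<^sub>Z Y)\<close> for all constant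
  vector fields, for which \<open>\<nabla>\<^sub>Z X = \<Gamma>(Z, X)\<close>.  These conditions determine \<open>\<Gamma>\<close> on
  \<open>U \<times> V \<times> V\<close> (and make it as smooth as the first derivative of \<open>g\<close>).
\<close>

definition levi_civita :: "'a::real_normed_vector set \<Rightarrow> 'a set \<Rightarrow> ('a \<Rightarrow> 'a \<Rightarrow> 'a \<Rightarrow> real)
    \<Rightarrow> ('a \<Rightarrow> 'a \<Rightarrow> 'a \<Rightarrow> 'a) \<Rightarrow> bool" where
  "levi_civita U V g \<Gamma> \<longleftrightarrow> (\<forall>P\<in>U. \<forall>X\<in>V. \<forall>Y\<in>V.
     \<Gamma> P X Y \<in> V \<and>
     (\<forall>X'\<in>V. \<forall>r s. \<Gamma> P (r *\<^sub>R X + s *\<^sub>R X') Y = r *\<^sub>R \<Gamma> P X Y + s *\<^sub>R \<Gamma> P X' Y) \<and>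
     \<Gamma> P X Y = \<Gamma> P Y X \<and>
     (\<forall>Z\<in>V. ((\<lambda>t. g (P + t *\<^sub>R Z) X Y) has_real_derivative
        g P (\<Gamma> P Z X) Y + g P X (\<Gamma> P Z Y)) (at 0)))"

text \<open>A geodesic is a curve with \<open>\<nabla>\<^sub>\<gamma>\<^sub>' \<gamma>' = 0\<close> for the Levi-Civita connection.\<close>

definition geodesic :: "'a::real_normed_vector set \<Rightarrow> 'a set \<Rightarrow> ('a \<Rightarrow> 'a \<Rightarrow> 'a \<Rightarrow> real)
    \<Rightarrow> real \<Rightarrow> real \<Rightarrow> (real \<Rightarrow> 'a) \<Rightarrow> bool" where
  "geodesic U V g a b \<gamma> \<longleftrightarrow> a < b \<and> \<gamma> ` {a..b} \<subseteq> U \<and>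
     (\<exists>\<Gamma> \<gamma>' \<gamma>''. levi_civita U V g \<Gamma> \<and> (\<forall>t\<in>{a..b}.
        (\<gamma> has_vector_derivative \<gamma>' t) (at t within {a..b}) \<and>
        (\<gamma>' has_vector_derivative \<gamma>'' t) (at t within {a..b}) \<and>
        \<gamma>'' t + \<Gamma> (\<gamma> t) (\<gamma>' t) (\<gamma>' t) = 0))"

definition curve_length :: "('a::real_normed_vector \<Rightarrow> 'a \<Rightarrow> 'a \<Rightarrow> real)
    \<Rightarrow> real \<Rightarrow> real \<Rightarrow> (real \<Rightarrow> 'a) \<Rightarrow> real" where
  "curve_length g a b \<gamma> = integral {a..b} (\<lambda>t.
     sqrt (g (\<gamma> t) (vector_derivative \<gamma> (at t within {a..b})) (vector_derivative \<gamma> (at t within {a..b}))))"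

definition curve_midpoint :: "('a::real_normed_vector \<Rightarrow> 'a \<Rightarrow> 'a \<Rightarrow> real)
    \<Rightarrow> real \<Rightarrow> real \<Rightarrow> (real \<Rightarrow> 'a) \<Rightarrow> 'a \<Rightarrow> bool" where
  "curve_midpoint g a b \<gamma> m \<longleftrightarrow>
     (\<exists>c\<in>{a..b}. \<gamma> c = m \<and> curve_length g a c \<gamma> = curve_length g c b \<gamma>)"

text \<open>Solutions of the geodesic equation have constant speed, so the admissible reparametrizations
  of a geodesic are the affine ones.\<close>

definition affine_reparametrization :: "real \<Rightarrow> real \<Rightarrow> (real \<Rightarrow> 'a) \<Rightarrow> real \<Rightarrow> real \<Rightarrow> (real \<Rightarrow> 'a) \<Rightarrow> bool" where
  "affine_reparametrization a b \<gamma> c d \<eta> \<longleftrightarrow>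
     (\<exists>r s. 0 < r \<and> r * c + s = a \<and> r * d + s = b \<and> (\<forall>t\<in>{c..d}. \<eta> t = \<gamma> (r * t + s)))"

definition t_geodesic_between :: "('n::finite, 'n, 'p::{finite,linorder}) tensor \<Rightarrow> ('n, 'n, 'p) tensor
    \<Rightarrow> real \<Rightarrow> real \<Rightarrow> (real \<Rightarrow> ('n, 'n, 'p) tensor) \<Rightarrow> bool" where
  "t_geodesic_between \<A> \<B> a b \<gamma> \<longleftrightarrow> geodesic t_pd t_herm t_metric a b \<gamma> \<and> \<gamma> a = \<A> \<and> \<gamma> b = \<B>"

end

theory Submission
  imports Defs
begin

text \<open>Under the T-product the tensors in \<open>\<complex>\<^bsup>n\<times>n\<times>p\<^esup>\<close> form a finite-dimensional algebra with the involution
\<open>\<A> \<mapsto> \<A>\<^sup>H\<close>, because \<open>bcirc\<close> is an injective homomorphism into matrices that turns the involution into the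
conjugate transpose.  The real Frobenius inner product satisfies \<open>\<langle>x y, z\<rangle> = \<langle>y, x\<^sup>H z\<rangle>\<close> and makes the
involution isometric.  Hence \<open>tr x = \<langle>1, x\<rangle>\<close> is a trace, and the Riemannian metric is
\<open>g\<^sub>P(X, Y) = p \<cdot> tr (P\<^sup>-\<^sup>1 X P\<^sup>-\<^sup>1 Y)\<close>.  Nothing else about tensors matters, so the geometry is done in the locale
\<open>star_algebra\<close> of such algebras.

The Levi-Civita connection of \<open>g\<close> is \<open>\<Gamma>\<^sub>P(X, Y) = - (X P\<^sup>-\<^sup>1 Y + Y P\<^sup>-\<^sup>1 X) / 2\<close>, by the product rule together
with the uniqueness of a symmetric metric connection (\<open>levi_civita_christoffel\<close>, \<open>levi_civita_unique\<close>).
The geodesic equation is therefore \<open>\<gamma>'' = \<gamma>' \<gamma>\<^sup>-\<^sup>1 \<gamma>'\<close>, which says exactly that \<open>\<gamma>\<^sup>-\<^sup>1 \<gamma>'\<close> is a constant \<open>k\<close>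
(\<open>geodesicE\<close>, \<open>geodesicI\<close>).  So geodesics solve a linear equation \<open>\<gamma>' = \<gamma> k\<close>, and those that start at \<open>A\<close> are
the curves \<open>t \<mapsto> A\<^bsup>1/2\<^esup> exp (t s) A\<^bsup>1/2\<^esup>\<close> with \<open>s\<close> Hermitian.

Such a curve reaches \<open>B\<close> at \<open>t = 1\<close> iff \<open>exp s = A\<^bsup>-1/2\<^esup> B A\<^bsup>-1/2\<^esup>\<close>.  Existence and uniqueness of the geodesic are
thus the statement that \<open>exp\<close> maps the Hermitian elements bijectively onto the positive ones.  Injectivity
follows by repeated halving from the uniqueness of positive square roots (\<open>expo_inj_on_herm\<close>); surjectivity
from the integral formula for the logarithm (\<open>expo_surj_pos\<close>).  Finally the speed of a geodesic is the
constant \<open>sqrt p \<cdot> \<parallel>s\<parallel>\<close>, so the midpoint is the value at \<open>t = 1/2\<close>, which is \<open>A \<sharp> B\<close> since \<open>exp (s/2)\<close> is the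
square root of \<open>exp s\<close>.\<close>

section \<open>The exponential in a Banach algebra\<close>

lemma has_vector_derivative_iff_slope:
  fixes f :: "real \<Rightarrow> 'b::real_normed_vector"
  shows "(f has_vector_derivative D) (at t within S) \<longleftrightarrow>
    ((\<lambda>s. (f s - f t) /\<^sub>R (s - t)) \<longlongrightarrow> D) (at t within S)"
proof -
  have "norm ((1 / norm (s - t)) *\<^sub>R (f s - (f t + (s - t) *\<^sub>R D))) = norm ((f s - f t) /\<^sub>R (s - t) - D)"
    if "s \<noteq> t" for s
  proof -
    have "(f s - f t) /\<^sub>R (s - t) - D = inverse (s - t) *\<^sub>R (f s - (f t + (s - t) *\<^sub>R D))"
      using that by (simp add: scaleR_diff_right scaleR_add_right)
    then show ?thesis
      by (simp add: divide_inverse)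
  qed
  then have "((\<lambda>s. norm ((1 / norm (s - t)) *\<^sub>R (f s - (f t + (s - t) *\<^sub>R D)))) \<longlongrightarrow> 0) (at t within S)
      \<longleftrightarrow> ((\<lambda>s. norm ((f s - f t) /\<^sub>R (s - t) - D)) \<longlongrightarrow> 0) (at t within S)"
    by (intro filterlim_cong refl) (auto simp: eventually_at_filter)
  then show ?thesis
    unfolding has_vector_derivative_def has_derivative_within tendsto_norm_zero_iff
    by (simp add: LIM_zero_iff bounded_linear_scaleR_left)
qed

lemma exp_commute:
  fixes x :: "'a::{real_normed_algebra_1,banach}"
  assumes "x * y = y * x"
  shows "exp x * y = y * exp x"
proof -
  have pow: "x ^ n * y = y * x ^ n" for n
    using assms by (metis power_commuting_commutes)
  have "exp x * y = (\<Sum>n. (x ^ n /\<^sub>R fact n) * y)"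
    unfolding exp_def by (rule suminf_mult2[OF summable_exp_generic])
  also have "\<dots> = (\<Sum>n. y * (x ^ n /\<^sub>R fact n))"
    by (simp add: pow)
  also have "\<dots> = y * exp x"
    unfolding exp_def by (rule suminf_mult[OF summable_exp_generic])
  finally show ?thesis .
qed

text \<open>Comparing the two exponential series term by term from the quadratic term on.\<close>

lemma norm_exp_minus_one_minus_le:
  fixes x :: "'a::{real_normed_algebra_1,banach}"
  shows "norm (exp x - 1 - x) \<le> exp (norm x) - 1 - norm x"
proof -
  let ?a = "\<lambda>n. x ^ (n + 2) /\<^sub>R fact (n + 2)"
  let ?b = "\<lambda>n. norm x ^ (n + 2) /\<^sub>R fact (n + 2)"
  have b: "summable ?b"
    using summable_exp_generic[of "norm x"] by (rule summable_ignore_initial_segment)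
  have le: "norm (?a n) \<le> ?b n" for n
    by (simp add: norm_power_ineq divide_right_mono del: power_Suc fact_Suc)
  have "exp x - 1 - x = (\<Sum>n. ?a n)"
    using exp_first_two_terms[of x] by simp
  moreover have "exp (norm x) - 1 - norm x = (\<Sum>n. ?b n)"
    using exp_first_two_terms[of "norm x"] by simp
  ultimately show ?thesis
    using norm_suminf_le[OF le b] by simp
qed

lemma has_derivative_exp_at_0:
  "((exp :: 'a \<Rightarrow> 'a::{real_normed_algebra_1,banach}) has_derivative (\<lambda>h. h)) (at 0)"
proof -
  have "((\<lambda>r::real. (exp r - 1 - r) / r) \<longlongrightarrow> 0) (at 0)"
  proof -
    have "((\<lambda>r::real. (exp r - exp 0) / (r - 0)) \<longlongrightarrow> exp 0) (at 0)"
      using DERIV_exp[of "0::real"] unfolding has_field_derivative_iff by simp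
    then have "((\<lambda>r::real. (exp r - 1) / r - 1) \<longlongrightarrow> 1 - 1) (at 0)"
      by (intro tendsto_diff) auto
    moreover have "\<forall>\<^sub>F r::real in at 0. (exp r - 1) / r - 1 = (exp r - 1 - r) / r"
      by (auto simp: eventually_at_filter field_simps)
    ultimately show ?thesis
      by (auto elim: Lim_transform_eventually)
  qed
  moreover have "filterlim (norm :: 'a \<Rightarrow> real) (at 0) (at 0)"
    by (auto simp: filterlim_at eventually_at_filter intro!: tendsto_norm_zero)
  ultimately have lim: "((\<lambda>h::'a. (exp (norm h) - 1 - norm h) / norm h) \<longlongrightarrow> 0) (at 0)"
    by (rule filterlim_compose)
  have "((\<lambda>h::'a. norm (exp h - 1 - h) / norm h) \<longlongrightarrow> 0) (at 0)"
    by (rule Lim_null_comparison[OF _ lim])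
       (auto intro!: always_eventually divide_right_mono norm_exp_minus_one_minus_le)
  then show ?thesis
    by (simp add: has_derivative_at)
qed

text \<open>In a noncommutative algebra \<open>exp\<close> has no simple derivative, but along a curve that commutes with \<open>L s\<close> the
factor \<open>exp (L s)\<close> splits off, and what remains is the derivative of \<open>exp\<close> at 0.\<close>

lemma has_vector_derivative_exp_commuting:
  fixes L :: "real \<Rightarrow> 'a::{real_normed_algebra_1,banach}"
  assumes L: "(L has_vector_derivative L') (at s within S)" and s: "s \<in> S"
    and comm: "\<And>t. t \<in> S \<Longrightarrow> L t * L s = L s * L t"
  shows "((\<lambda>t. exp (L t)) has_vector_derivative exp (L s) * L') (at s within S)"
proof -
  have "((\<lambda>t. L t - L s) has_derivative (\<lambda>h. h *\<^sub>R L')) (at s within S)"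
    using L unfolding has_vector_derivative_def by (auto intro!: derivative_eq_intros)
  moreover have "(exp has_derivative (\<lambda>h. h)) (at (L s - L s))"
    using has_derivative_exp_at_0 by simp
  ultimately have "((\<lambda>t. exp (L t - L s)) has_derivative (\<lambda>h. h *\<^sub>R L')) (at s within S)"
    by (rule has_derivative_compose)
  then have "((\<lambda>t. exp (L s) * exp (L t - L s)) has_vector_derivative exp (L s) * L') (at s within S)"
    by (intro has_vector_derivative_mult_right) (simp add: has_vector_derivative_def)
  moreover have "exp (L t) = exp (L s) * exp (L t - L s)" if "t \<in> S" for t
    using exp_add_commuting[of "L s" "L t - L s"] comm[OF that] by (simp add: algebra_simps)
  ultimately show ?thesis
    by (rule has_vector_derivative_transform[OF s, rotated])
qed

section \<open>Endomorphisms of a Euclidean space as a Banach algebra\<close>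

text \<open>The series of \<open>exp\<close> calls for a submultiplicative norm with value 1 at the unit, which the norm of an inner
product on an algebra need not be.  The operator norm has both properties, and every algebra acts on itself
by left multiplication.\<close>

typedef (overloaded) 'a endo = "UNIV :: ('a::euclidean_space \<Rightarrow>\<^sub>L 'a) set"
  morphisms blinfun_of_endo endo_of_blinfun ..

setup_lifting type_definition_endo

instantiation endo :: (euclidean_space) real_normed_algebra_1
begin

lift_definition zero_endo :: "'a endo" is 0 .
lift_definition one_endo :: "'a endo" is id_blinfun .
lift_definition plus_endo :: "'a endo \<Rightarrow> 'a endo \<Rightarrow> 'a endo" is "(+)" .
lift_definition minus_endo :: "'a endo \<Rightarrow> 'a endo \<Rightarrow> 'a endo" is "(-)" .
lift_definition uminus_endo :: "'a endo \<Rightarrow> 'a endo" is uminus .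
lift_definition times_endo :: "'a endo \<Rightarrow> 'a endo \<Rightarrow> 'a endo" is blinfun_compose .
lift_definition scaleR_endo :: "real \<Rightarrow> 'a endo \<Rightarrow> 'a endo" is scaleR .
lift_definition norm_endo :: "'a endo \<Rightarrow> real" is norm .
lift_definition sgn_endo :: "'a endo \<Rightarrow> 'a endo" is sgn .
lift_definition dist_endo :: "'a endo \<Rightarrow> 'a endo \<Rightarrow> real" is dist .

definition uniformity_endo :: "('a endo \<times> 'a endo) filter" where
  "uniformity_endo = (INF e\<in>{0<..}. principal {(x, y). dist x y < e})"
definition open_endo :: "'a endo set \<Rightarrow> bool" where
  "open_endo U = (\<forall>x\<in>U. \<forall>\<^sub>F (x', y) in uniformity. x' = x \<longrightarrow> y \<in> U)"

instance
proof
  fix x y z :: "'a endo" and a b :: real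
  show "dist x y = norm (x - y)" by transfer (rule dist_norm)
  show "x + y + z = x + (y + z)" "x + y = y + x" "0 + x = x" "- x + x = 0" "x - y = x + - y"
    by (transfer; simp)+
  show "a *\<^sub>R (x + y) = a *\<^sub>R x + a *\<^sub>R y" "(a + b) *\<^sub>R x = a *\<^sub>R x + b *\<^sub>R x"
    "a *\<^sub>R b *\<^sub>R x = (a * b) *\<^sub>R x" "1 *\<^sub>R x = x"
    by (transfer; simp add: algebra_simps)+
  show "x * y * z = x * (y * z)" by transfer (auto intro!: blinfun_eqI)
  show "1 * x = x" "x * 1 = x" by (transfer; auto intro!: blinfun_eqI)+
  show "(x + y) * z = x * z + y * z" "x * (y + z) = x * y + x * z"
    "a *\<^sub>R x * y = a *\<^sub>R (x * y)" "x * a *\<^sub>R y = a *\<^sub>R (x * y)"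
    by (transfer; auto intro!: blinfun_eqI simp: blinfun.bilinear_simps)+
  show "norm (x * y) \<le> norm x * norm y" by transfer (rule norm_blinfun_compose)
  show "norm (1 :: 'a endo) = 1" by transfer (rule norm_blinfun_id)
  show "sgn x = inverse (norm x) *\<^sub>R x" by transfer (rule sgn_div_norm)
  show "norm x = 0 \<longleftrightarrow> x = 0" by transfer simp
  show "norm (x + y) \<le> norm x + norm y" by transfer (rule norm_triangle_ineq)
  show "norm (a *\<^sub>R x) = \<bar>a\<bar> * norm x" by transfer simp
  have "norm (1::'a endo) \<noteq> norm (0::'a endo)" by transfer (simp)
  then show "(0 :: 'a endo) \<noteq> 1" by metis
  show "uniformity = (INF e\<in>{0<..}. principal {(x, y). dist (x::'a endo) y < e})"
    by (rule uniformity_endo_def)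
  show "open U = (\<forall>x\<in>U. \<forall>\<^sub>F (x', y) in uniformity. x' = x \<longrightarrow> y \<in> U)" for U :: "'a endo set"
    by (rule open_endo_def)
qed

end

instance endo :: (euclidean_space) banach
proof
  fix X :: "nat \<Rightarrow> 'a endo"
  assume "Cauchy X"
  then have "Cauchy (\<lambda>n. blinfun_of_endo (X n))"
    unfolding Cauchy_def dist_endo.rep_eq .
  then obtain l where l: "(\<lambda>n. blinfun_of_endo (X n)) \<longlonglongrightarrow> l"
    using Cauchy_convergent convergentD by blast
  have "X \<longlonglongrightarrow> endo_of_blinfun l"
    using l unfolding lim_sequentially dist_endo.rep_eq by (simp add: endo_of_blinfun_inverse)
  then show "convergent X"
    by (rule convergentI)
qed


definition endo_apply :: "'a::euclidean_space endo \<Rightarrow> 'a \<Rightarrow> 'a" where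
  "endo_apply T = blinfun_apply (blinfun_of_endo T)"

lemma endo_eqI: "(\<And>x. endo_apply S x = endo_apply T x) \<Longrightarrow> S = T"
  unfolding endo_apply_def by transfer (rule blinfun_eqI)

lemma endo_apply_simps [simp]:
  "endo_apply (S * T) x = endo_apply S (endo_apply T x)"
  "endo_apply 1 x = x"
  unfolding endo_apply_def by (transfer; simp)+

lemma bounded_linear_endo_apply: "bounded_linear (\<lambda>T. endo_apply T x)"
proof (rule bounded_linear_intro)
  show "endo_apply (S + T) x = endo_apply S x + endo_apply T x"
    and "endo_apply (r *\<^sub>R T) x = r *\<^sub>R endo_apply T x" for S T r
    unfolding endo_apply_def by (transfer; simp add: blinfun.bilinear_simps)+
  show "norm (endo_apply T x) \<le> norm T * norm x" for T
    unfolding endo_apply_def norm_endo.rep_eq by (rule norm_blinfun)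
qed

section \<open>Star algebras with a tracial inner product\<close>

text \<open>The finite-dimensional real \<open>H\<^sup>*\<close>-algebras with unit: left multiplication by \<open>star x\<close> is the adjoint of left
multiplication by \<open>x\<close>.\<close>

locale star_algebra =
  fixes mult :: "'a::euclidean_space \<Rightarrow> 'a \<Rightarrow> 'a" (infixl "\<odot>" 70)
    and unit :: 'a ("\<one>")
    and star :: "'a \<Rightarrow> 'a"
  assumes bounded_bilinear_mult: "bounded_bilinear (\<odot>)"
    and mult_assoc: "(x \<odot> y) \<odot> z = x \<odot> (y \<odot> z)"
    and unit_left [simp]: "\<one> \<odot> x = x"
    and unit_right [simp]: "x \<odot> \<one> = x"
    and bounded_linear_star: "bounded_linear star"
    and star_star [simp]: "star (star x) = x"
    and star_mult: "star (x \<odot> y) = star y \<odot> star x"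
    and inner_star: "star x \<bullet> star y = x \<bullet> y"
    and inner_mult_left: "(x \<odot> y) \<bullet> z = y \<bullet> (star x \<odot> z)"
begin

sublocale mul: bounded_bilinear "(\<odot>)" by (rule bounded_bilinear_mult)

lemmas star_add = linear_add[OF bounded_linear.linear[OF bounded_linear_star]]
  and star_diff = linear_diff[OF bounded_linear.linear[OF bounded_linear_star]]
  and star_scaleR = linear_scale[OF bounded_linear.linear[OF bounded_linear_star]]
  and has_vector_derivative_star = bounded_linear.has_vector_derivative[OF bounded_linear_star]

lemmas mul_simps = mul.add_left mul.add_right mul.diff_left mul.diff_right mul.scaleR_left
  mul.scaleR_right mul.minus_left mul.minus_right

lemma star_unit [simp]: "star \<one> = \<one>"
  by (metis star_mult star_star unit_right)

definition tr :: "'a \<Rightarrow> real" where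
  "tr x = \<one> \<bullet> x"

lemma tr_mult: "tr (x \<odot> y) = star x \<bullet> y"
  unfolding tr_def by (metis inner_mult_left star_star unit_right)

lemma tr_mult_commute: "tr (x \<odot> y) = tr (y \<odot> x)"
  by (metis inner_commute inner_star star_star tr_mult)

lemma bounded_linear_tr: "bounded_linear tr"
  unfolding tr_def by (rule bounded_linear_inner_right)

definition herm :: "'a set" where
  "herm = {x. star x = x}"

definition pos :: "'a set" where
  "pos = {x \<in> herm. \<forall>y. y \<noteq> 0 \<longrightarrow> 0 < y \<bullet> (x \<odot> y)}"

lemma hermI: "star x = x \<Longrightarrow> x \<in> herm" and hermD: "x \<in> herm \<Longrightarrow> star x = x"
  by (simp_all add: herm_def)

lemma pos_herm: "x \<in> pos \<Longrightarrow> x \<in> herm"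
  by (simp add: pos_def)

lemma posD: "x \<in> pos \<Longrightarrow> y \<noteq> 0 \<Longrightarrow> 0 < y \<bullet> (x \<odot> y)"
  by (simp add: pos_def)

lemma herm_add: "x \<in> herm \<Longrightarrow> y \<in> herm \<Longrightarrow> x + y \<in> herm"
  and herm_diff: "x \<in> herm \<Longrightarrow> y \<in> herm \<Longrightarrow> x - y \<in> herm"
  and herm_scaleR: "x \<in> herm \<Longrightarrow> r *\<^sub>R x \<in> herm"
  and herm_unit: "\<one> \<in> herm"
  and herm_sandwich: "x \<in> herm \<Longrightarrow> y \<in> herm \<Longrightarrow> y \<odot> x \<odot> y \<in> herm"
  by (simp_all add: herm_def star_add star_diff star_scaleR star_mult mult_assoc)

lemma unit_pos: "\<one> \<in> pos"
  by (simp add: pos_def herm_unit)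

lemma pos_convex: 
  assumes "x \<in> pos" "y \<in> pos" "0 \<le> u" "u \<le> (1::real)"
  shows "(1 - u) *\<^sub>R x + u *\<^sub>R y \<in> pos"
proof -
  have "0 < z \<bullet> (((1 - u) *\<^sub>R x + u *\<^sub>R y) \<odot> z)" if "z \<noteq> 0" for z
  proof -
    have "0 < (1 - u) * (z \<bullet> (x \<odot> z)) + u * (z \<bullet> (y \<odot> z))"
      using posD[OF assms(1) that] posD[OF assms(2) that] assms(3,4)
      by (cases "u = 0") (auto intro!: add_nonneg_pos)
    then show ?thesis
      by (simp add: mul_simps inner_add_right)
  qed
  then show ?thesis
    using assms by (auto simp: pos_def intro!: herm_add herm_scaleR)
qed

definition inv :: "'a \<Rightarrow> 'a" where
  "inv x = (THE y. x \<odot> y = \<one> \<and> y \<odot> x = \<one>)"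

definition invertible :: "'a \<Rightarrow> bool" where
  "invertible x \<longleftrightarrow> (\<exists>y. x \<odot> y = \<one> \<and> y \<odot> x = \<one>)"

lemma inv_eqI: "x \<odot> y = \<one> \<Longrightarrow> y \<odot> x = \<one> \<Longrightarrow> inv x = y"
  unfolding inv_def by (rule the_equality) (auto, metis mult_assoc unit_left unit_right)

lemma invertibleI: "x \<odot> y = \<one> \<Longrightarrow> y \<odot> x = \<one> \<Longrightarrow> invertible x"
  by (auto simp: invertible_def)

lemma mult_inv: "invertible x \<Longrightarrow> x \<odot> inv x = \<one>"
  and inv_mult: "invertible x \<Longrightarrow> inv x \<odot> x = \<one>"
  using inv_eqI by (auto simp: invertible_def)

lemma mult_inv_cancel: "invertible x \<Longrightarrow> x \<odot> (inv x \<odot> y) = y"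
  and inv_mult_cancel: "invertible x \<Longrightarrow> inv x \<odot> (x \<odot> y) = y"
  by (simp_all add: mult_assoc[symmetric] mult_inv inv_mult)

lemmas inv_simps = mult_inv inv_mult mult_inv_cancel inv_mult_cancel

lemma invertible_inv: "invertible x \<Longrightarrow> invertible (inv x)"
  by (metis inv_mult invertibleI mult_inv)

lemma inv_unit [simp]: "inv \<one> = \<one>"
  by (simp add: inv_eqI)

lemma star_inv:
  assumes "invertible x"
  shows "star (inv x) = inv (star x)"
  by (rule inv_eqI[symmetric]) (simp_all add: star_mult[symmetric] inv_simps assms)

lemma inv_commute:
  assumes "invertible x" "x \<odot> y = y \<odot> x"
  shows "inv x \<odot> y = y \<odot> inv x"
proof -
  have "inv x \<odot> y = inv x \<odot> (y \<odot> x) \<odot> inv x"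
    by (simp add: mult_assoc inv_simps assms(1))
  also have "\<dots> = y \<odot> inv x"
    by (simp add: assms(2)[symmetric] mult_assoc inv_simps assms(1))
  finally show ?thesis .
qed

text \<open>Left multiplication by \<open>x\<close> is an injective linear map of a finite-dimensional space, so it attains the unit;
the right inverse found in this way becomes a left inverse under the involution.\<close>

lemma pos_invertible:
  assumes x: "x \<in> pos"
  shows "invertible x"
proof -
  have "linear ((\<odot>) x)"
    by (rule bounded_linear.linear[OF mul.bounded_linear_right])
  moreover have "inj ((\<odot>) x)"
  proof (rule injI)
    fix y z assume "x \<odot> y = x \<odot> z"
    then have "(y - z) \<bullet> (x \<odot> (y - z)) = 0"
      by (simp add: mul_simps)
    then show "y = z"
      using posD[OF x, of "y - z"] by auto
  qed
  ultimately have "surj ((\<odot>) x)"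
    by (rule linear_injective_imp_surjective) simp
  then obtain y where y: "x \<odot> y = \<one>"
    by (metis surjD)
  have "star y \<odot> x = \<one>"
    using y pos_herm[OF x] by (metis hermD star_mult star_unit)
  then show ?thesis
    using y by (metis invertibleI mult_assoc unit_left unit_right)
qed

lemma herm_inv: "invertible x \<Longrightarrow> x \<in> herm \<Longrightarrow> inv x \<in> herm"
  by (simp add: herm_def star_inv)

lemma pos_congruence:
  assumes x: "x \<in> pos" and y: "y \<in> herm" "invertible y"
  shows "y \<odot> x \<odot> y \<in> pos"
proof -
  have "0 < z \<bullet> (y \<odot> x \<odot> y \<odot> z)" if "z \<noteq> 0" for z
  proof -
    have "y \<odot> z \<noteq> 0"
      using that y(2) by (metis inv_mult_cancel mul.zero_right)
    then have "0 < (y \<odot> z) \<bullet> (x \<odot> (y \<odot> z))"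
      by (rule posD[OF x])
    then show ?thesis
      using y(1) by (simp add: inner_mult_left hermD mult_assoc)
  qed
  then show ?thesis
    using x y by (auto simp: pos_def herm_sandwich)
qed

lemma pos_square:
  assumes "y \<in> herm" "invertible y"
  shows "y \<odot> y \<in> pos"
  using pos_congruence[OF unit_pos assms] by simp

text \<open>With \<open>d = x - y\<close>, the hypothesis reads \<open>x d + d y = 0\<close>.  Pairing with \<open>d\<close> gives the sum
\<open>\<langle>d, x d\<rangle> + \<langle>d, y d\<rangle> = 0\<close> of two terms that are positive unless \<open>d = 0\<close>.\<close>

lemma pos_sqrt_unique:
  assumes x: "x \<in> pos" and y: "y \<in> pos" and eq: "x \<odot> x = y \<odot> y"
  shows "x = y"
proof (rule ccontr)
  assume "x \<noteq> y"
  let ?d = "x - y"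
  have d: "?d \<in> herm"
    using x y by (simp add: herm_diff pos_herm)
  have "x \<odot> ?d + ?d \<odot> y = 0"
    by (simp add: mul_simps eq)
  then have "0 = ?d \<bullet> (x \<odot> ?d + ?d \<odot> y)"
    by simp
  also have "\<dots> = ?d \<bullet> (x \<odot> ?d) + ?d \<bullet> (?d \<odot> y)"
    by (rule inner_add_right)
  also have "?d \<bullet> (?d \<odot> y) = ?d \<bullet> (y \<odot> ?d)"
    using inner_star[of ?d "?d \<odot> y"] hermD[OF d] hermD[OF pos_herm[OF y]]
    by (simp add: star_mult)
  finally show False
    using posD[OF x, of ?d] posD[OF y, of ?d] \<open>x \<noteq> y\<close> by simp
qed

text \<open>The resolvent identity \<open>y\<^sup>-\<^sup>1 - x\<^sup>-\<^sup>1 = - x\<^sup>-\<^sup>1 (y - x) y\<^sup>-\<^sup>1\<close> first bounds the norm of \<open>y\<^sup>-\<^sup>1\<close>, for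
\<open>y\<close> near \<open>x\<close>, by twice the norm of \<open>x\<^sup>-\<^sup>1\<close>, and with this bound it gives the limit.\<close>

lemma inv_tendsto:
  assumes f: "(f \<longlongrightarrow> x) F" and inv: "\<forall>\<^sub>F t in F. invertible (f t)" and x: "invertible x"
  shows "((\<lambda>t. inv (f t)) \<longlongrightarrow> inv x) F"
proof -
  obtain K where K: "\<And>a b. norm (a \<odot> b) \<le> norm a * norm b * K" and K0: "0 \<le> K"
    using mul.nonneg_bounded by blast
  let ?q = "inv x"
  have diff: "inv y - ?q = - (?q \<odot> (y - x) \<odot> inv y)" if "invertible y" for y
    using that x by (simp add: mul_simps mult_assoc inv_simps)
  \<comment> \<open>the resolvent identity costs two applications of the norm bound for products, hence \<open>K * K\<close>\<close>
  define c where "c t = norm ?q * K * K * norm (f t - x)" for t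
  have c0: "0 \<le> c t" for t
    using K0 by (simp add: c_def)
  have c: "(c \<longlongrightarrow> 0) F"
    unfolding c_def using f by (intro tendsto_mult_right_zero tendsto_norm_zero LIM_zero) 
  have le: "norm (inv (f t) - ?q) \<le> c t * norm (inv (f t))" if "invertible (f t)" for t
  proof -
    have "norm (inv (f t) - ?q) \<le> norm (?q \<odot> (f t - x)) * norm (inv (f t)) * K"
      using K diff[OF that] by simp
    also have "\<dots> \<le> (norm ?q * norm (f t - x) * K) * norm (inv (f t)) * K"
      by (intro mult_right_mono K K0) simp
    finally show ?thesis
      by (simp add: c_def mult_ac)
  qed
  have "\<forall>\<^sub>F t in F. c t < 1 / 2"
    by (rule order_tendstoD[OF c]) simp
  then have "\<forall>\<^sub>F t in F. norm (inv (f t) - ?q) \<le> c t * (2 * norm ?q)"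
    using inv
  proof eventually_elim
    case (elim t)
    have "norm (inv (f t)) \<le> norm ?q + norm (inv (f t) - ?q)"
      using norm_triangle_ineq[of ?q "inv (f t) - ?q"] by simp
    also have "\<dots> \<le> norm ?q + c t * norm (inv (f t))"
      using le[OF elim(2)] by simp
    also have "\<dots> \<le> norm ?q + 1 / 2 * norm (inv (f t))"
      using elim(1) by (intro add_left_mono mult_right_mono) auto
    finally have "norm (inv (f t)) \<le> 2 * norm ?q"
      by simp
    then show ?case
      using le[OF elim(2)] mult_left_mono[OF _ c0] order_trans by blast
  qed
  then have "((\<lambda>t. inv (f t) - ?q) \<longlongrightarrow> 0) F"
    by (rule Lim_null_comparison) (rule tendsto_mult_left_zero[OF c])
  then show ?thesis
    by (rule LIM_zero_cancel)
qed

lemma has_vector_derivative_inv: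
  assumes f: "(f has_vector_derivative f') (at t within S)" and t: "t \<in> S"
    and inv: "\<And>s. s \<in> S \<Longrightarrow> invertible (f s)"
  shows "((\<lambda>s. inv (f s)) has_vector_derivative - (inv (f t) \<odot> f' \<odot> inv (f t))) (at t within S)"
proof -
  let ?F = "at t within S"
  let ?q = "inv (f t)"
  have S: "\<forall>\<^sub>F s in ?F. s \<in> S \<and> s \<noteq> t"
    by (simp add: eventually_at_filter)
  have ev: "\<forall>\<^sub>F s in ?F. invertible (f s)"
    using S by eventually_elim (simp add: inv)
  have "(f \<longlongrightarrow> f t) ?F"
    using has_vector_derivative_continuous[OF f] by (simp add: continuous_within)
  then have "((\<lambda>s. inv (f s)) \<longlongrightarrow> ?q) ?F"
    by (rule inv_tendsto[OF _ ev inv[OF t]])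
  moreover have slope: "((\<lambda>s. (f s - f t) /\<^sub>R (s - t)) \<longlongrightarrow> f') ?F"
    using f unfolding has_vector_derivative_iff_slope .
  ultimately have "((\<lambda>s. - (?q \<odot> ((f s - f t) /\<^sub>R (s - t)) \<odot> inv (f s))) \<longlongrightarrow> - (?q \<odot> f' \<odot> ?q)) ?F"
    by (intro tendsto_minus mul.tendsto tendsto_const)
  then have "((\<lambda>s. (inv (f s) - ?q) /\<^sub>R (s - t)) \<longlongrightarrow> - (?q \<odot> f' \<odot> ?q)) ?F"
  proof (rule Lim_transform_eventually)
    show "\<forall>\<^sub>F s in ?F. - (?q \<odot> ((f s - f t) /\<^sub>R (s - t)) \<odot> inv (f s)) = (inv (f s) - ?q) /\<^sub>R (s - t)"
      using ev by eventually_elim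
        (simp add: mul_simps mult_assoc inv_simps inv[OF t] scaleR_diff_right)
  qed
  then show ?thesis
    unfolding has_vector_derivative_iff_slope .
qed

end

section \<open>Exponential and logarithm in a star algebra\<close>

context star_algebra begin

definition lmul :: "'a \<Rightarrow> 'a endo" where
  "lmul x = endo_of_blinfun (Blinfun ((\<odot>) x))"

definition expo :: "'a \<Rightarrow> 'a" where
  "expo x = endo_apply (exp (lmul x)) \<one>"

lemma lmul_apply [simp]: "endo_apply (lmul x) y = x \<odot> y"
  by (simp add: endo_apply_def lmul_def endo_of_blinfun_inverse bounded_linear_Blinfun_apply
      mul.bounded_linear_right)

lemma lmul_mult: "lmul (x \<odot> y) = lmul x * lmul y"
  by (rule endo_eqI) (simp add: mult_assoc)

lemma bounded_linear_lmul: "bounded_linear lmul"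
proof -
  obtain K where K: "\<And>a b. norm (a \<odot> b) \<le> norm a * norm b * K" and K0: "0 \<le> K"
    using mul.nonneg_bounded by blast
  interpret ev: bounded_linear "\<lambda>T. endo_apply T x" for x
    by (rule bounded_linear_endo_apply)
  show ?thesis
  proof (rule bounded_linear_intro)
    show "lmul (x + y) = lmul x + lmul y" "lmul (r *\<^sub>R x) = r *\<^sub>R lmul x" for x y r
      by (rule endo_eqI, simp add: ev.add ev.scaleR mul_simps)+
    show "norm (lmul x) \<le> norm x * K" for x
      unfolding norm_endo.rep_eq
    proof (rule norm_blinfun_bound)
      show "norm (blinfun_apply (blinfun_of_endo (lmul x)) y) \<le> norm x * K * norm y" for y
        using K[of x y] by (simp add: endo_apply_def[symmetric] mult_ac)
    qed (simp add: K0)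
  qed
qed

lemmas lmul_add = linear_add[OF bounded_linear.linear[OF bounded_linear_lmul]]
  and lmul_0 = linear_0[OF bounded_linear.linear[OF bounded_linear_lmul]]

text \<open>\<open>exp (lmul x)\<close> commutes with every right multiplication because \<open>lmul x\<close> does, and an operator that commutes
with right multiplications is the left multiplication by its value at the unit.\<close>

lemma exp_lmul: "exp (lmul x) = lmul (expo x)"
proof (rule endo_eqI)
  fix y
  define rmul where "rmul = endo_of_blinfun (Blinfun (\<lambda>z. z \<odot> y))"
  have rmul: "endo_apply rmul z = z \<odot> y" for z
    by (simp add: endo_apply_def rmul_def endo_of_blinfun_inverse bounded_linear_Blinfun_apply
        mul.bounded_linear_left)
  have "exp (lmul x) * rmul = rmul * exp (lmul x)"
    by (intro exp_commute endo_eqI) (simp add: rmul mult_assoc)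
  then have "endo_apply (exp (lmul x) * rmul) \<one> = endo_apply (rmul * exp (lmul x)) \<one>"
    by simp
  then show "endo_apply (exp (lmul x)) y = endo_apply (lmul (expo x)) y"
    by (simp add: rmul expo_def)
qed

lemma expo_0 [simp]: "expo 0 = \<one>"
  by (simp add: expo_def lmul_0)

lemma expo_add:
  assumes "x \<odot> y = y \<odot> x"
  shows "expo (x + y) = expo x \<odot> expo y"
proof -
  have "lmul x * lmul y = lmul y * lmul x"
    by (simp only: lmul_mult[symmetric] assms)
  then have "exp (lmul (x + y)) = exp (lmul x) * exp (lmul y)"
    unfolding lmul_add by (rule exp_add_commuting)
  then have "endo_apply (lmul (expo (x + y))) \<one> = endo_apply (lmul (expo x) * lmul (expo y)) \<one>"
    by (simp only: exp_lmul)
  then show ?thesis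
    by simp
qed

lemma expo_minus: "expo x \<odot> expo (- x) = \<one>" "expo (- x) \<odot> expo x = \<one>"
  using expo_add[of x "- x"] expo_add[of "- x" x] by (simp_all add: mul_simps)

lemma invertible_expo: "invertible (expo x)"
  using expo_minus by (rule invertibleI)

lemma has_vector_derivative_expo_commuting:
  assumes L: "(L has_vector_derivative L') (at s within S)" and s: "s \<in> S"
    and comm: "\<And>t. t \<in> S \<Longrightarrow> L t \<odot> L s = L s \<odot> L t"
  shows "((\<lambda>t. expo (L t)) has_vector_derivative expo (L s) \<odot> L') (at s within S)"
proof -
  have "((\<lambda>t. exp (lmul (L t))) has_vector_derivative exp (lmul (L s)) * lmul L') (at s within S)"
    by (intro has_vector_derivative_exp_commuting bounded_linear.has_vector_derivative[OF bounded_linear_lmul] L s)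
      (simp only: lmul_mult[symmetric] comm)
  from bounded_linear.has_vector_derivative[OF bounded_linear_endo_apply this, of \<one>]
  show ?thesis
    unfolding expo_def by (simp add: exp_lmul)
qed

lemma has_vector_derivative_expo:
  "((\<lambda>t. expo (t *\<^sub>R x)) has_vector_derivative expo (t *\<^sub>R x) \<odot> x) (at t within S)"
proof -
  have "((\<lambda>t. t *\<^sub>R x) has_vector_derivative x) (at t within insert t S)"
    by (auto intro!: derivative_eq_intros simp: has_vector_derivative_def)
  then have "((\<lambda>t. expo (t *\<^sub>R x)) has_vector_derivative expo (t *\<^sub>R x) \<odot> x) (at t within insert t S)"
    by (rule has_vector_derivative_expo_commuting) (simp_all add: mul_simps)
  then show ?thesis
    by (rule has_vector_derivative_within_subset) auto
qed

lemma zero_derivative_eq: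
  fixes f :: "real \<Rightarrow> 'a"
  assumes "\<And>t. t \<in> {a..b} \<Longrightarrow> (f has_vector_derivative 0) (at t within {a..b})"
    and "s \<in> {a..b}"
  shows "f s = f a"
proof -
  obtain k where "\<And>t. t \<in> {a..b} \<Longrightarrow> f t = k"
    using has_vector_derivative_zero_constant[of "{a..b}" f] assms(1) by auto
  then show ?thesis
    using assms(2) by auto
qed

lemma expo_commute:
  assumes "x \<odot> y = y \<odot> x"
  shows "expo x \<odot> y = y \<odot> expo x"
proof -
  have "exp (lmul x) * lmul y = lmul y * exp (lmul x)"
    by (intro exp_commute) (simp only: lmul_mult[symmetric] assms)
  then have "endo_apply (exp (lmul x) * lmul y) \<one> = endo_apply (lmul y * exp (lmul x)) \<one>"
    by simp
  then show ?thesis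
    by (simp add: exp_lmul)
qed

text \<open>Multiplying \<open>f\<close> with the inverse of the expected solution gives a curve with zero derivative.\<close>

lemma linear_ode_unique:
  assumes f: "\<And>t. t \<in> {a..b} \<Longrightarrow> (f has_vector_derivative f t \<odot> x) (at t within {a..b})"
    and t: "t \<in> {a..b}"
  shows "f t = f a \<odot> expo ((t - a) *\<^sub>R x)"
proof -
  let ?e = "\<lambda>t. expo ((t - a) *\<^sub>R - x)"
  have e: "(?e has_vector_derivative ?e t \<odot> - x) (at t within {a..b})" if "t \<in> {a..b}" for t
  proof (rule has_vector_derivative_expo_commuting[OF _ that])
    show "((\<lambda>t. (t - a) *\<^sub>R - x) has_vector_derivative - x) (at t within {a..b})"
      by (auto intro!: derivative_eq_intros simp: has_vector_derivative_def)
  qed (simp add: mul_simps)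
  have comm: "?e t \<odot> x = x \<odot> ?e t" for t
    by (rule expo_commute) (simp add: mul_simps)
  have "((\<lambda>t. f t \<odot> ?e t) has_vector_derivative 0) (at t within {a..b})" if "t \<in> {a..b}" for t
    using mul.has_vector_derivative[OF f[OF that] e[OF that]] comm[of t]
    by (simp add: mul_simps mult_assoc)
  then have "f t \<odot> ?e t = f a \<odot> ?e a"
    by (rule zero_derivative_eq[OF _ t])
  then have "f t \<odot> ?e t \<odot> expo ((t - a) *\<^sub>R x) = f a \<odot> expo ((t - a) *\<^sub>R x)"
    by simp
  then show ?thesis
    by (simp add: mult_assoc expo_minus)
qed

text \<open>Both sides solve the same linear differential equation along the ray through \<open>x\<close>.\<close>

lemma star_expo: "star (expo x) = expo (star x)"
proof -
  let ?f = "\<lambda>t. star (expo (t *\<^sub>R x))"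
  have "(?f has_vector_derivative ?f t \<odot> star x) (at t within {0..1})" for t
    using has_vector_derivative_star[OF has_vector_derivative_expo[of x t]]
    using expo_commute[of "t *\<^sub>R x" x]
    by (simp add: mul_simps flip: star_mult)
  then have "?f 1 = ?f 0 \<odot> expo ((1 - 0) *\<^sub>R star x)"
    by (intro linear_ode_unique) auto
  then show ?thesis
    by simp
qed

lemma expo_half: "expo ((1 / 2) *\<^sub>R x) \<odot> expo ((1 / 2) *\<^sub>R x) = expo x"
  by (simp add: expo_add[symmetric] scaleR_add_left[symmetric])

lemma expo_pos:
  assumes "x \<in> herm"
  shows "expo x \<in> pos"
proof -
  have "expo ((1 / 2) *\<^sub>R x) \<in> herm"
    using assms by (simp add: herm_def star_expo star_scaleR)
  then show ?thesis
    using pos_square[OF _ invertible_expo] expo_half by metis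
qed

text \<open>\<open>exp (x/2)\<close> is the positive square root of \<open>exp x\<close>, so \<open>exp x = exp y\<close> can be halved again and again, and \<open>x\<close> is
the limit of \<open>2\<^sup>n (exp (x/2\<^sup>n) - 1)\<close>.\<close>

lemma expo_inj_on_herm:
  assumes x: "x \<in> herm" and y: "y \<in> herm" and eq: "expo x = expo y"
  shows "x = y"
proof -
  let ?r = "\<lambda>n. (1 / 2) ^ n :: real"
  have dyadic: "expo (?r n *\<^sub>R x) = expo (?r n *\<^sub>R y)" for n
  proof (induction n)
    case (Suc n)
    have "expo (?r (Suc n) *\<^sub>R z) \<odot> expo (?r (Suc n) *\<^sub>R z) = expo (?r n *\<^sub>R z)" for z
      using expo_half[of "?r n *\<^sub>R z"] by simp
    note square = this[of x] this[of y]
    show ?case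
      by (rule pos_sqrt_unique[OF expo_pos[OF herm_scaleR[OF x]] expo_pos[OF herm_scaleR[OF y]]])
        (simp only: square Suc.IH)
  qed (simp add: eq)
  have lim: "(\<lambda>n. (expo (?r n *\<^sub>R z) - \<one>) /\<^sub>R ?r n) \<longlonglongrightarrow> z" for z
  proof -
    have "((\<lambda>s. (expo (s *\<^sub>R z) - expo (0 *\<^sub>R z)) /\<^sub>R (s - 0)) \<longlongrightarrow> expo (0 *\<^sub>R z) \<odot> z) (at 0)"
      using has_vector_derivative_expo[of z 0] unfolding has_vector_derivative_iff_slope .
    moreover have "filterlim ?r (at 0) sequentially"
      by (auto simp: filterlim_at intro!: tendsto_intros LIMSEQ_power_zero)
    ultimately show ?thesis
      using filterlim_compose by fastforce
  qed
  show ?thesis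
    using LIMSEQ_unique[OF lim[of x]] lim[of y] by (simp add: dyadic)
qed

text \<open>The logarithm is \<open>log c = \<integral> (c - 1) (1 + u (c - 1))\<^sup>-\<^sup>1 du\<close> over \<open>0 \<le> u \<le> 1\<close>.  On the segment \<open>C s\<close> from \<open>1\<close> to \<open>c\<close>, which
consists of positive elements, the partial integral \<open>L s\<close> satisfies \<open>L' = C' C\<^sup>-\<^sup>1\<close>; all its values commute, so
\<open>exp (L s) C(s)\<^sup>-\<^sup>1\<close> is constant.\<close>

lemma expo_surj_pos:
  assumes c: "c \<in> pos"
  shows "\<exists>x\<in>herm. expo x = c"
proof -
  define C where "C s = (1 - s) *\<^sub>R \<one> + s *\<^sub>R c" for s
  define W where "W s = (c - \<one>) \<odot> inv (C s)" for s
  define L where "L s = integral {0..s} W" for s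
  let ?I = "{0..1::real}"
  have C_pos: "C s \<in> pos" if "s \<in> ?I" for s
    using that unfolding C_def by (intro pos_convex unit_pos c) auto
  note C_inv = pos_invertible[OF C_pos]
  have C_deriv: "(C has_vector_derivative c - \<one>) (at s within ?I)" for s
    unfolding C_def
    by (auto intro!: derivative_eq_intros simp: has_vector_derivative_def algebra_simps)
  have inv_C_deriv: "((\<lambda>s. inv (C s)) has_vector_derivative
      - (inv (C s) \<odot> (c - \<one>) \<odot> inv (C s))) (at s within ?I)" if "s \<in> ?I" for s
    by (rule has_vector_derivative_inv[OF C_deriv that C_inv])
  have "continuous_on ?I (\<lambda>s. inv (C s))"
    using inv_C_deriv by (rule continuous_on_vector_derivative)
  then have W_cont: "continuous_on ?I W"
    unfolding W_def by (intro mul.continuous_on continuous_on_const)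
  have W_int: "W integrable_on {0..s}" if "s \<in> ?I" for s
    using that by (intro integrable_continuous_real continuous_on_subset[OF W_cont]) auto
  have L_deriv: "(L has_vector_derivative W s) (at s within ?I)" if "s \<in> ?I" for s
    unfolding L_def by (rule integral_has_vector_derivative[OF W_cont that])
  have C_comm: "C s \<odot> (c - \<one>) = (c - \<one>) \<odot> C s" for s
    by (simp add: C_def mul_simps algebra_simps)
  have W_eq: "W s = inv (C s) \<odot> (c - \<one>)" if "s \<in> ?I" for s
    using inv_commute[OF C_inv[OF that] C_comm] by (simp add: W_def)
  have L_comm: "y \<odot> L s = L s \<odot> y" if s: "s \<in> ?I" and y: "\<And>u. u \<in> ?I \<Longrightarrow> y \<odot> W u = W u \<odot> y" for y s
  proof -
    have "y \<odot> L s = integral {0..s} (\<lambda>u. y \<odot> W u)"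
      unfolding L_def using integral_linear[OF W_int[OF s] mul.bounded_linear_right[of y]]
      by (simp add: o_def)
    also have "\<dots> = integral {0..s} (\<lambda>u. W u \<odot> y)"
      using s y by (intro integral_cong) auto
    also have "\<dots> = L s \<odot> y"
      unfolding L_def using integral_linear[OF W_int[OF s] mul.bounded_linear_left[of y]]
      by (simp add: o_def)
    finally show ?thesis .
  qed
  have W_comm: "W u \<odot> W s = W s \<odot> W u" if "u \<in> ?I" "s \<in> ?I" for u s
  proof -
    have "C u \<odot> C s = C s \<odot> C u" 
      by (simp add: C_def mul_simps algebra_simps)
    then have "inv (C u) \<odot> C s = C s \<odot> inv (C u)"
      by (rule inv_commute[OF C_inv[OF that(1)]])
    then have *: "inv (C s) \<odot> inv (C u) = inv (C u) \<odot> inv (C s)"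
      by (intro inv_commute[OF C_inv[OF that(2)]]) simp
    have "W u \<odot> W s = (c - \<one>) \<odot> (inv (C u) \<odot> inv (C s)) \<odot> (c - \<one>)"
      using that by (simp add: W_def[of u] W_eq[of s] mult_assoc)
    also have "\<dots> = W s \<odot> W u"
      using that by (simp add: W_def[of s] W_eq[of u] mult_assoc *[symmetric])
    finally show ?thesis .
  qed
  have LW_comm: "W u \<odot> L s = L s \<odot> W u" if "u \<in> ?I" "s \<in> ?I" for u s
    using that by (intro L_comm W_comm)
  have LL_comm: "L u \<odot> L s = L s \<odot> L u" if "u \<in> ?I" "s \<in> ?I" for u s
    using that by (intro L_comm LW_comm[symmetric])
  have G_deriv: "((\<lambda>s. expo (L s) \<odot> inv (C s)) has_vector_derivative 0) (at s within ?I)" if s: "s \<in> ?I" for s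
  proof -
    have "((\<lambda>s. expo (L s)) has_vector_derivative expo (L s) \<odot> W s) (at s within ?I)"
      by (rule has_vector_derivative_expo_commuting[OF L_deriv[OF s] s LL_comm[OF _ s]])
    from mul.has_vector_derivative[OF this inv_C_deriv[OF s]]
    show ?thesis
      using s by (simp add: W_eq mul_simps mult_assoc)
  qed
  have "expo (L 1) \<odot> inv (C 1) = expo (L 0) \<odot> inv (C 0)"
    by (rule zero_derivative_eq[OF G_deriv]) auto
  then have "expo (L 1) \<odot> inv c = \<one>"
    by (simp add: C_def L_def)
  then have "expo (L 1) \<odot> (inv c \<odot> c) = c"
    by (metis mult_assoc unit_left)
  then have "expo (L 1) = c"
    by (simp add: inv_simps pos_invertible[OF c])
  moreover have "L 1 \<in> herm"
  proof -
    have "star (W u) = W u" if "u \<in> ?I" for u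
      using that C_inv[OF that] pos_herm[OF C_pos[OF that]] pos_herm[OF c]
      by (simp add: W_def star_mult star_inv hermD star_diff)
        (simp add: W_eq[symmetric] W_def)
    then have "integral {0..1} (\<lambda>u. star (W u)) = integral {0..1} W"
      by (intro integral_cong) auto
    then have "star (L 1) = L 1"
      unfolding L_def using integral_linear[OF W_int bounded_linear_star, of 1]
      by (simp add: o_def)
    then show ?thesis
      by (rule hermI)
  qed
  ultimately show ?thesis
    by blast
qed

end

section \<open>The Levi-Civita connection of the positive cone\<close>

text \<open>The difference of two such connections gives a function \<open>a X Y Z\<close> that is symmetric in its first two
arguments, since both are torsion-free, and skew in its last two, since both are compatible with \<open>g\<close>.  Such a
function vanishes, and \<open>g\<close> is nondegenerate.\<close>

lemma levi_civita_unique: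
  assumes \<Gamma>: "levi_civita U V g \<Gamma>" and \<Delta>: "levi_civita U V g \<Delta>"
    and V: "\<And>X Y. X \<in> V \<Longrightarrow> Y \<in> V \<Longrightarrow> X - Y \<in> V" and P: "P \<in> U"
    and diff: "\<And>X Y Z. X \<in> V \<Longrightarrow> Y \<in> V \<Longrightarrow> Z \<in> V \<Longrightarrow> g P (X - Y) Z = g P X Z - g P Y Z"
    and sym: "\<And>X Y. X \<in> V \<Longrightarrow> Y \<in> V \<Longrightarrow> g P X Y = g P Y X"
    and nondegenerate: "\<And>W. W \<in> V \<Longrightarrow> (\<And>Z. Z \<in> V \<Longrightarrow> g P W Z = 0) \<Longrightarrow> W = 0"
    and X: "X \<in> V" and Y: "Y \<in> V"
  shows "\<Gamma> P X Y = \<Delta> P X Y"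
proof -
  define a where "a X Y Z = g P (\<Gamma> P X Y - \<Delta> P X Y) Z" for X Y Z
  have mem: "\<Gamma> P X Y \<in> V" "\<Delta> P X Y \<in> V" and symm: "\<Gamma> P X Y = \<Gamma> P Y X" "\<Delta> P X Y = \<Delta> P Y X"
    if "X \<in> V" "Y \<in> V" for X Y
    using \<Gamma> \<Delta> P that unfolding levi_civita_def by blast+
  have a_sym: "a X Y Z = a Y X Z" if "X \<in> V" "Y \<in> V" for X Y Z
    using symm[OF that] by (simp add: a_def)
  have a_skew: "a Z X Y = - a Z Y X" if "X \<in> V" "Y \<in> V" "Z \<in> V" for X Y Z
  proof -
    have "((\<lambda>t. g (P + t *\<^sub>R Z) X Y) has_real_derivative g P (\<Gamma> P Z X) Y + g P X (\<Gamma> P Z Y)) (at 0)"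
      and "((\<lambda>t. g (P + t *\<^sub>R Z) X Y) has_real_derivative g P (\<Delta> P Z X) Y + g P X (\<Delta> P Z Y)) (at 0)"
      using \<Gamma> \<Delta> P that unfolding levi_civita_def by blast+
    then have "g P (\<Gamma> P Z X) Y + g P X (\<Gamma> P Z Y) = g P (\<Delta> P Z X) Y + g P X (\<Delta> P Z Y)"
      by (rule DERIV_unique)
    then show ?thesis
      using that by (simp add: a_def diff mem sym[of X])
  qed
  have "a X Y Z = 0" if Z: "Z \<in> V" for Z
    using a_sym[OF X Y, of Z] a_sym[OF X Z, of Y] a_sym[OF Y Z, of X]
      a_skew[OF X Y Z] a_skew[OF X Z Y] a_skew[OF Y Z X] by linarith
  then have "\<Gamma> P X Y - \<Delta> P X Y = 0"
    using X Y by (intro nondegenerate) (auto simp: a_def V mem)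
  then show ?thesis
    by simp
qed

context star_algebra begin

text \<open>The positive cone is open in the Hermitian elements: on the compact unit sphere the form \<open>\<langle>y, p y\<rangle>\<close> is bounded
below by some \<open>m > 0\<close>.\<close>

lemma pos_add_small:
  assumes p: "p \<in> pos" and z: "z \<in> herm"
  shows "\<exists>d>0. \<forall>t. \<bar>t\<bar> < d \<longrightarrow> p + t *\<^sub>R z \<in> pos"
proof -
  let ?S = "sphere (0::'a) 1"
  obtain b :: 'a where "b \<in> Basis"
    using nonempty_Basis by blast
  then have "b \<in> ?S"
    by simp
  then have "?S \<noteq> {}"
    by blast
  moreover have "continuous_on ?S (\<lambda>y. y \<bullet> (p \<odot> y))"
    by (intro continuous_on_inner mul.continuous_on continuous_intros)
  ultimately have "\<exists>w\<in>?S. \<forall>y\<in>?S. w \<bullet> (p \<odot> w) \<le> y \<bullet> (p \<odot> y)"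
    by (rule continuous_attains_inf[OF compact_sphere])
  then obtain w where w: "w \<in> ?S" "\<And>y. y \<in> ?S \<Longrightarrow> w \<bullet> (p \<odot> w) \<le> y \<bullet> (p \<odot> y)"
    by blast
  define m where "m = w \<bullet> (p \<odot> w)"
  have "w \<noteq> 0"
    using w(1) by auto
  then have m: "0 < m"
    unfolding m_def by (rule posD[OF p])
  obtain K where K: "\<And>a b. norm (a \<odot> b) \<le> norm a * norm b * K" and K0: "0 < K"
    using mul.pos_bounded by blast
  define d where "d = m / (norm z * K + 1)"
  have den: "0 < norm z * K + 1"
    using K0 by (simp add: add_nonneg_pos)
  have "0 < y \<bullet> ((p + t *\<^sub>R z) \<odot> y)" if t: "\<bar>t\<bar> < d" and "y \<noteq> 0" for t y
  proof -
    let ?u = "y /\<^sub>R norm y"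
    have u: "norm ?u = 1"
      using \<open>y \<noteq> 0\<close> by simp
    have "\<bar>?u \<bullet> (z \<odot> ?u)\<bar> \<le> norm z * K"
      using Cauchy_Schwarz_ineq2[of ?u "z \<odot> ?u"] K[of z ?u] u by simp
    then have "\<bar>t * (?u \<bullet> (z \<odot> ?u))\<bar> \<le> \<bar>t\<bar> * (norm z * K)"
      unfolding abs_mult by (rule mult_left_mono) simp
    also have "\<dots> \<le> \<bar>t\<bar> * (norm z * K + 1)"
      by (rule mult_left_mono) auto
    also have "\<dots> < m"
      using t den by (simp add: d_def pos_less_divide_eq)
    also have "m \<le> ?u \<bullet> (p \<odot> ?u)"
      unfolding m_def using u by (intro w(2)) simp
    finally have "0 < ?u \<bullet> ((p + t *\<^sub>R z) \<odot> ?u)"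
      by (simp add: mul.add_left mul.scaleR_left inner_add_right abs_less_iff)
    also have "?u \<bullet> ((p + t *\<^sub>R z) \<odot> ?u) = y \<bullet> ((p + t *\<^sub>R z) \<odot> y) / (norm y)\<^sup>2"
      by (simp add: mul.scaleR_right power2_eq_square divide_inverse)
    finally show ?thesis
      using \<open>y \<noteq> 0\<close> by (simp add: zero_less_divide_iff)
  qed
  then have "\<forall>t. \<bar>t\<bar> < d \<longrightarrow> p + t *\<^sub>R z \<in> pos"
    using z pos_herm[OF p] by (auto simp: pos_def intro: herm_add herm_scaleR)
  moreover have "0 < d"
    using m den by (simp add: d_def)
  ultimately show ?thesis
    by blast
qed

text \<open>The weight \<open>\<kappa>\<close> absorbs the factor between \<open>tr\<close> and another trace on the same algebra.\<close>

definition metric :: "real \<Rightarrow> 'a \<Rightarrow> 'a \<Rightarrow> 'a \<Rightarrow> real" where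
  "metric \<kappa> p x y = \<kappa> * tr (inv p \<odot> x \<odot> inv p \<odot> y)"

definition christoffel :: "'a \<Rightarrow> 'a \<Rightarrow> 'a \<Rightarrow> 'a" where
  "christoffel p x y = - (1 / 2) *\<^sub>R (x \<odot> inv p \<odot> y + y \<odot> inv p \<odot> x)"

lemma tr_cyclic: "tr (a \<odot> b \<odot> c \<odot> d) = tr (c \<odot> d \<odot> a \<odot> b)"
  using tr_mult_commute[of "a \<odot> b" "c \<odot> d"] by (simp add: mult_assoc)

lemma metric_sym: "metric \<kappa> p x y = metric \<kappa> p y x"
  unfolding metric_def by (simp add: tr_cyclic[of "inv p" x])

text \<open>The test vector \<open>p w p\<close> turns \<open>g\<^sub>p(w, \<cdot>)\<close> into \<open>\<kappa> \<cdot> tr (w w)\<close>, which is \<open>\<kappa>\<close> times the squared norm of \<open>w\<close>.\<close>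

lemma metric_nondegenerate:
  assumes "0 < \<kappa>" "p \<in> pos" "w \<in> herm" and zero: "\<And>z. z \<in> herm \<Longrightarrow> metric \<kappa> p w z = 0"
  shows "w = 0"
proof -
  have p: "invertible p"
    by (rule pos_invertible) fact
  have "tr (inv p \<odot> w \<odot> inv p \<odot> (p \<odot> w \<odot> p)) = tr (inv p \<odot> (w \<odot> w) \<odot> p)"
    by (simp add: mult_assoc inv_simps p)
  also have "\<dots> = tr (w \<odot> w)"
    by (simp add: tr_mult_commute[of _ p] inv_simps p)
  also have "\<dots> = w \<bullet> w"
    using assms(3) by (simp add: tr_mult hermD)
  finally show ?thesis
    using zero[of "p \<odot> w \<odot> p"] assms by (simp add: metric_def herm_sandwich pos_herm)
qed

text \<open>By the product rule, \<open>tr (q x q y)\<close> with \<open>q = (p + t z)\<^sup>-\<^sup>1\<close> has derivative \<open>- tr (q z q x q y) - tr (q x q z q y)\<close>.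
The two connection terms produce each of these traces with total weight \<open>-1\<close> once \<open>tr (q x q y q z)\<close> is rotated
into \<open>tr (q z q x q y)\<close>.\<close>

lemma levi_civita_christoffel: "levi_civita pos herm (metric \<kappa>) christoffel"
  unfolding levi_civita_def
proof (intro ballI conjI allI)
  fix p x y assume p: "p \<in> pos" and x: "x \<in> herm" and y: "y \<in> herm"
  have inv_p: "star (inv p) = inv p"
    by (intro hermD herm_inv pos_invertible pos_herm p)
  show "christoffel p x y \<in> herm"
    using x y unfolding christoffel_def
    by (intro herm_scaleR hermI) (simp add: star_add star_mult inv_p hermD mult_assoc add.commute)
  show "christoffel p (r *\<^sub>R x + s *\<^sub>R x') y = r *\<^sub>R christoffel p x y + s *\<^sub>R christoffel p x' y" for x' r s
    by (simp add: christoffel_def mul_simps algebra_simps)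
  show "christoffel p x y = christoffel p y x"
    by (simp add: christoffel_def add.commute)
  fix z assume z: "z \<in> herm"
  obtain d where d: "0 < d" "\<And>t. \<bar>t\<bar> < d \<Longrightarrow> p + t *\<^sub>R z \<in> pos"
    using pos_add_small[OF p z] by blast
  let ?D = "{- d<..<d}" and ?q = "inv p"
  have "((\<lambda>t. p + t *\<^sub>R z) has_vector_derivative z) (at 0 within ?D)"
    by (auto intro!: derivative_eq_intros simp: has_vector_derivative_def)
  then have q: "((\<lambda>t. inv (p + t *\<^sub>R z)) has_vector_derivative - (?q \<odot> z \<odot> ?q)) (at 0 within ?D)"
    using d(1) pos_invertible[OF d(2)]
      has_vector_derivative_inv[of "\<lambda>t. p + t *\<^sub>R z" z 0 ?D] by (simp add: abs_less_iff)
  have qx: "((\<lambda>t. inv (p + t *\<^sub>R z) \<odot> w) has_vector_derivative - (?q \<odot> z \<odot> ?q) \<odot> w) (at 0 within ?D)" for w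
    by (rule bounded_linear.has_vector_derivative[OF mul.bounded_linear_left q])
  have "((\<lambda>t. tr ((inv (p + t *\<^sub>R z) \<odot> x) \<odot> (inv (p + t *\<^sub>R z) \<odot> y))) has_vector_derivative
      tr ((?q \<odot> x) \<odot> (- (?q \<odot> z \<odot> ?q) \<odot> y) + (- (?q \<odot> z \<odot> ?q) \<odot> x) \<odot> (?q \<odot> y))) (at 0 within ?D)"
    using bounded_linear.has_vector_derivative[OF bounded_linear_tr mul.has_vector_derivative[OF qx qx]]
    by simp
  then have "((\<lambda>t. metric \<kappa> (p + t *\<^sub>R z) x y) has_vector_derivative
      \<kappa> * tr ((?q \<odot> x) \<odot> (- (?q \<odot> z \<odot> ?q) \<odot> y) + (- (?q \<odot> z \<odot> ?q) \<odot> x) \<odot> (?q \<odot> y))) (at 0 within ?D)"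
    unfolding metric_def mult_assoc by (rule has_vector_derivative_mult_right)
  \<comment> \<open>inverses are under control only while \<open>p + t z\<close> is positive, which is why the derivative is taken on \<open>?D\<close>\<close>
  moreover have "at (0::real) within ?D = at 0"
    using d by (intro at_within_open) auto
  moreover have "\<kappa> * tr ((?q \<odot> x) \<odot> (- (?q \<odot> z \<odot> ?q) \<odot> y) + (- (?q \<odot> z \<odot> ?q) \<odot> x) \<odot> (?q \<odot> y))
     = metric \<kappa> p (christoffel p z x) y + metric \<kappa> p x (christoffel p z y)"
  proof -
    interpret tr: bounded_linear tr by (rule bounded_linear_tr)
    have "tr (?q \<odot> (x \<odot> (?q \<odot> (y \<odot> (?q \<odot> z))))) = tr (?q \<odot> (z \<odot> (?q \<odot> (x \<odot> (?q \<odot> y)))))"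
      using tr_mult_commute[of "?q \<odot> x \<odot> ?q \<odot> y" "?q \<odot> z"] by (simp add: mult_assoc)
    moreover have "metric \<kappa> p (christoffel p z x) y = - (\<kappa> / 2) *
        (tr (?q \<odot> (z \<odot> (?q \<odot> (x \<odot> (?q \<odot> y))))) + tr (?q \<odot> (x \<odot> (?q \<odot> (z \<odot> (?q \<odot> y))))))"
      "metric \<kappa> p x (christoffel p z y) = - (\<kappa> / 2) *
        (tr (?q \<odot> (x \<odot> (?q \<odot> (z \<odot> (?q \<odot> y))))) + tr (?q \<odot> (x \<odot> (?q \<odot> (y \<odot> (?q \<odot> z))))))"
      unfolding metric_def christoffel_def
      by (simp_all only: mul_simps mult_assoc tr.add tr.scaleR) simp_all
    moreover have "tr ((?q \<odot> x) \<odot> (- (?q \<odot> z \<odot> ?q) \<odot> y) + (- (?q \<odot> z \<odot> ?q) \<odot> x) \<odot> (?q \<odot> y))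
      = - tr (?q \<odot> (x \<odot> (?q \<odot> (z \<odot> (?q \<odot> y))))) - tr (?q \<odot> (z \<odot> (?q \<odot> (x \<odot> (?q \<odot> y)))))"
      by (simp only: mul_simps mult_assoc tr.add tr.neg)
    ultimately show ?thesis
      by (simp only:) (simp add: algebra_simps)
  qed
  ultimately show "((\<lambda>t. metric \<kappa> (p + t *\<^sub>R z) x y) has_real_derivative
      metric \<kappa> p (christoffel p z x) y + metric \<kappa> p x (christoffel p z y)) (at 0)"
    by (simp add: has_real_derivative_iff_has_vector_derivative)
qed

lemma levi_civita_eq_christoffel:
  assumes "0 < \<kappa>" "levi_civita pos herm (metric \<kappa>) \<Gamma>" "p \<in> pos" "x \<in> herm" "y \<in> herm"
  shows "\<Gamma> p x y = christoffel p x y"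
proof (rule levi_civita_unique[OF assms(2) levi_civita_christoffel herm_diff assms(3) _ _ _ assms(4,5)])
  interpret tr: bounded_linear tr by (rule bounded_linear_tr)
  show "metric \<kappa> p (x - y) z = metric \<kappa> p x z - metric \<kappa> p y z" for x y z
    by (simp add: metric_def mul_simps tr.diff right_diff_distrib)
qed (use assms in \<open>auto intro: metric_sym metric_nondegenerate\<close>)

lemma christoffel_diagonal: "christoffel p x x = - (x \<odot> inv p \<odot> x)"
  by (simp add: christoffel_def scaleR_2[symmetric])

section \<open>Geodesics and the geometric mean\<close>

lemma herm_derivative:
  assumes "a < b" "t \<in> {a..b}" "\<And>s. s \<in> {a..b} \<Longrightarrow> f s \<in> herm"
    and f: "(f has_vector_derivative f') (at t within {a..b})"
  shows "f' \<in> herm"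
proof (rule hermI)
  have "((\<lambda>s. star (f s)) has_vector_derivative star f') (at t within {a..b})"
    by (rule has_vector_derivative_star[OF f])
  then have "(f has_vector_derivative star f') (at t within {a..b})"
    by (rule has_vector_derivative_transform[OF assms(2), rotated]) (simp add: assms(3) hermD)
  then show "star f' = f'"
    using vector_derivative_within_closed_interval[OF assms(1,2)] f by metis
qed

text \<open>For \<open>\<gamma>' = \<gamma> k\<close> both \<open>\<gamma>''\<close> and \<open>\<gamma>' \<gamma>\<^sup>-\<^sup>1 \<gamma>'\<close> are equal to \<open>\<gamma> k k\<close>.\<close>

lemma geodesicI:
  assumes "a < b" and pos: "\<And>t. t \<in> {a..b} \<Longrightarrow> \<gamma> t \<in> pos"
    and \<gamma>: "\<And>t. t \<in> {a..b} \<Longrightarrow> (\<gamma> has_vector_derivative \<gamma> t \<odot> k) (at t within {a..b})"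
  shows "geodesic pos herm (metric \<kappa>) a b \<gamma>"
  unfolding geodesic_def
proof (intro conjI exI ballI)
  show "\<gamma> ` {a..b} \<subseteq> pos" using pos by auto
  show "levi_civita pos herm (metric \<kappa>) christoffel" by (rule levi_civita_christoffel)
  fix t assume t: "t \<in> {a..b}"
  show "(\<gamma> has_vector_derivative \<gamma> t \<odot> k) (at t within {a..b})" by (rule \<gamma>[OF t])
  then show "((\<lambda>t. \<gamma> t \<odot> k) has_vector_derivative \<gamma> t \<odot> k \<odot> k) (at t within {a..b})"
    by (rule bounded_linear.has_vector_derivative[OF mul.bounded_linear_left])
  show "\<gamma> t \<odot> k \<odot> k + christoffel (\<gamma> t) (\<gamma> t \<odot> k) (\<gamma> t \<odot> k) = 0"
    using pos_invertible[OF pos[OF t]] by (simp add: christoffel_diagonal mult_assoc inv_simps)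
qed fact

text \<open>The geodesic equation \<open>\<gamma>'' = \<gamma>' \<gamma>\<^sup>-\<^sup>1 \<gamma>'\<close> makes the derivative of \<open>\<gamma>\<^sup>-\<^sup>1 \<gamma>'\<close> zero.  The velocity is Hermitian because the
curve stays in the closed subspace of Hermitian elements; only there is the connection determined.\<close>

lemma geodesicE:
  assumes geo: "geodesic pos herm (metric \<kappa>) a b \<gamma>" and "0 < \<kappa>"
  obtains k where "\<gamma> a \<odot> k \<in> herm"
    "\<And>t. t \<in> {a..b} \<Longrightarrow> (\<gamma> has_vector_derivative \<gamma> t \<odot> k) (at t within {a..b})"
proof -
  from geo have ab: "a < b" and pos: "\<And>t. t \<in> {a..b} \<Longrightarrow> \<gamma> t \<in> pos"
    by (auto simp: geodesic_def)
  from geo obtain \<Gamma> \<gamma>' \<gamma>'' where \<Gamma>: "levi_civita pos herm (metric \<kappa>) \<Gamma>"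
    and all: "\<forall>t\<in>{a..b}. (\<gamma> has_vector_derivative \<gamma>' t) (at t within {a..b}) \<and>
      (\<gamma>' has_vector_derivative \<gamma>'' t) (at t within {a..b}) \<and>
      \<gamma>'' t + \<Gamma> (\<gamma> t) (\<gamma>' t) (\<gamma>' t) = 0"
    unfolding geodesic_def by blast
  have \<gamma>': "(\<gamma> has_vector_derivative \<gamma>' t) (at t within {a..b})"
    and \<gamma>'': "(\<gamma>' has_vector_derivative \<gamma>'' t) (at t within {a..b})"
    and eq: "\<gamma>'' t + \<Gamma> (\<gamma> t) (\<gamma>' t) (\<gamma>' t) = 0" if "t \<in> {a..b}" for t
    using all that by blast+
  have herm: "\<gamma>' t \<in> herm" if "t \<in> {a..b}" for t
    by (rule herm_derivative[OF ab that pos_herm[OF pos] \<gamma>'[OF that]])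
  have eq': "\<gamma>'' t = \<gamma>' t \<odot> inv (\<gamma> t) \<odot> \<gamma>' t" if "t \<in> {a..b}" for t
    using eq[OF that] levi_civita_eq_christoffel[OF \<open>0 < \<kappa>\<close> \<Gamma> pos herm herm, OF that that that]
    by (simp add: christoffel_diagonal)
  define k where "k = inv (\<gamma> a) \<odot> \<gamma>' a"
  have "((\<lambda>t. inv (\<gamma> t) \<odot> \<gamma>' t) has_vector_derivative 0) (at t within {a..b})" if t: "t \<in> {a..b}" for t
    using mul.has_vector_derivative[OF has_vector_derivative_inv[OF \<gamma>'[OF t] t pos_invertible[OF pos]] \<gamma>''[OF t]]
    by (simp add: eq'[OF t] mul_simps mult_assoc)
  then have k: "inv (\<gamma> t) \<odot> \<gamma>' t = k" if "t \<in> {a..b}" for t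
    unfolding k_def by (rule zero_derivative_eq[OF _ that])
  have vel: "\<gamma>' t = \<gamma> t \<odot> k" if "t \<in> {a..b}" for t
    using pos_invertible[OF pos[OF that]] by (simp add: k[OF that, symmetric] inv_simps)
  show ?thesis
  proof (rule that)
    show "\<gamma> a \<odot> k \<in> herm"
      using vel[of a] herm[of a] ab by simp
    show "(\<gamma> has_vector_derivative \<gamma> t \<odot> k) (at t within {a..b})" if "t \<in> {a..b}" for t
      using \<gamma>'[OF that] vel[OF that] by simp
  qed
qed

definition msqrt :: "'a \<Rightarrow> 'a" where
  "msqrt x = (THE y. y \<in> pos \<and> y \<odot> y = x)"

lemma msqrt_expo:
  assumes "x \<in> herm"
  shows "msqrt (expo x) = expo ((1 / 2) *\<^sub>R x)"
  unfolding msqrt_def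
  using assms expo_half[of x] pos_sqrt_unique[of _ "expo ((1 / 2) *\<^sub>R x)"]
  by (intro the_equality) (auto intro: expo_pos herm_scaleR)

lemma msqrt_pos: "x \<in> pos \<Longrightarrow> msqrt x \<in> pos"
  and msqrt_square: "x \<in> pos \<Longrightarrow> msqrt x \<odot> msqrt x = x"
  using expo_surj_pos[of x] expo_pos[OF herm_scaleR] by (auto simp: msqrt_expo expo_half)

text \<open>The geodesic that starts at \<open>p\<close> with velocity \<open>p\<^bsup>1/2\<^esup> s p\<^bsup>1/2\<^esup>\<close>.\<close>

definition geodesic_path :: "'a \<Rightarrow> 'a \<Rightarrow> real \<Rightarrow> 'a" where
  "geodesic_path p s t = msqrt p \<odot> expo (t *\<^sub>R s) \<odot> msqrt p"

context
  fixes p s :: 'a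
  assumes p: "p \<in> pos" and s: "s \<in> herm"
begin

lemma msqrt_invertible: "invertible (msqrt p)"
  by (intro pos_invertible msqrt_pos p)

lemma geodesic_path_0: "geodesic_path p s 0 = p"
  by (simp add: geodesic_path_def msqrt_square p)

lemma geodesic_path_pos: "geodesic_path p s t \<in> pos"
  unfolding geodesic_path_def
  by (intro pos_congruence expo_pos herm_scaleR s msqrt_invertible pos_herm msqrt_pos p)

text \<open>The constant value of \<open>\<gamma>\<^sup>-\<^sup>1 \<gamma>'\<close> along the geodesic \<open>\<gamma>\<close>.\<close>

abbreviation (input) direction :: 'a where
  "direction \<equiv> inv (msqrt p) \<odot> s \<odot> msqrt p"

lemma geodesic_path_derivative:
  "(geodesic_path p s has_vector_derivative geodesic_path p s t \<odot> direction) (at t within S)"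
proof -
  have "bounded_linear (\<lambda>x. msqrt p \<odot> x \<odot> msqrt p)"
    using bounded_linear_compose[OF mul.bounded_linear_left mul.bounded_linear_right] .
  from bounded_linear.has_vector_derivative[OF this has_vector_derivative_expo[of s t S]]
  show ?thesis
    unfolding geodesic_path_def[abs_def] by (simp add: mult_assoc inv_simps msqrt_invertible)
qed

lemma geodesic_geodesic_path: "a < b \<Longrightarrow> geodesic pos herm (metric \<kappa>) a b (geodesic_path p s)"
  by (rule geodesicI[OF _ geodesic_path_pos geodesic_path_derivative])

text \<open>For a curve with \<open>\<gamma>' = \<gamma> k\<close> the squared speed is \<open>\<kappa> \<cdot> tr (k k)\<close> at every point, and \<open>k\<close> is conjugate to \<open>s\<close>,
so that \<open>tr (k k) = tr (s s) = \<parallel>s\<parallel>\<^sup>2\<close>.\<close>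

lemma curve_length_geodesic_path:
  assumes "a \<le> b"
  shows "curve_length (metric \<kappa>) a b (geodesic_path p s) = (b - a) * (sqrt \<kappa> * norm s)"
proof (cases "a = b")
  case False
  then have ab: "a < b" using assms by simp
  have vd: "vector_derivative (geodesic_path p s) (at t within {a..b}) = geodesic_path p s t \<odot> direction"
    if "t \<in> {a..b}" for t
    by (rule vector_derivative_within_closed_interval[OF ab that geodesic_path_derivative])
  have "tr (direction \<odot> direction) = tr (inv (msqrt p) \<odot> (s \<odot> s) \<odot> msqrt p)"
    by (simp add: mult_assoc inv_simps msqrt_invertible)
  also have "\<dots> = tr (s \<odot> s)"
    by (simp add: tr_mult_commute[of _ "msqrt p"] inv_simps msqrt_invertible)
  also have "\<dots> = (norm s)\<^sup>2"
    using s by (simp add: tr_mult hermD power2_norm_eq_inner)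
  finally have "metric \<kappa> x (x \<odot> direction) (x \<odot> direction) = \<kappa> * (norm s)\<^sup>2" if "x \<in> pos" for x
    using pos_invertible[OF that] by (simp add: metric_def mult_assoc inv_simps)
  then have "curve_length (metric \<kappa>) a b (geodesic_path p s) = integral {a..b} (\<lambda>t. sqrt \<kappa> * norm s)"
    unfolding curve_length_def
    by (intro integral_cong) (simp add: vd geodesic_path_pos real_sqrt_mult)
  also have "\<dots> = (b - a) * (sqrt \<kappa> * norm s)"
    using assms by simp
  finally show ?thesis .
qed (simp add: curve_length_def)

text \<open>For \<open>s = 0\<close> the curve is constant, and every parameter value halves its zero length; the midpoint is still unique
as a point.\<close>

lemma curve_midpoint_geodesic_path:
  assumes \<kappa>: "0 < \<kappa>"
  shows "curve_midpoint (metric \<kappa>) 0 1 (geodesic_path p s) m \<longleftrightarrow> m = geodesic_path p s (1 / 2)"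
proof -
  let ?N = "sqrt \<kappa> * norm s"
  have "curve_midpoint (metric \<kappa>) 0 1 (geodesic_path p s) m \<longleftrightarrow>
      (\<exists>c\<in>{0..1}. geodesic_path p s c = m \<and> c * ?N = (1 - c) * ?N)"
    unfolding curve_midpoint_def by (intro bex_cong refl) (simp add: curve_length_geodesic_path)
  also have "\<dots> \<longleftrightarrow> m = geodesic_path p s (1 / 2)"
  proof (cases "s = 0")
    case True
    then show ?thesis
      by (auto simp: geodesic_path_def intro: bexI[of _ 0])
  next
    case False
    have eq: "c * ?N = (1 - c) * ?N \<longleftrightarrow> c = 1 / 2" for c
      using False \<kappa> by auto
    have "(1 / 2 :: real) \<in> {0..1}"
      by simp
    then show ?thesis
      unfolding eq by blast
  qed
  finally show ?thesis .
qed

text \<open>Normalizing \<open>\<eta>\<close> to \<open>p\<^bsup>-1/2\<^esup> \<eta> p\<^bsup>-1/2\<^esup>\<close> moves its start to the unit and makes the constant \<open>z\<close> in its linear equation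
Hermitian, so it is \<open>exp ((t - c) z)\<close>.  Its end point then determines \<open>(d - c) z = s\<close>, because \<open>exp\<close> is injective on
Hermitian elements.\<close>

lemma geodesic_unique:
  assumes \<kappa>: "0 < \<kappa>" and geo: "geodesic pos herm (metric \<kappa>) c d \<eta>"
    and ends: "\<eta> c = p" "\<eta> d = geodesic_path p s 1"
  shows "affine_reparametrization 0 1 (geodesic_path p s) c d \<eta>"
proof -
  have cd: "c < d"
    using geo by (simp add: geodesic_def)
  obtain k where k: "\<eta> c \<odot> k \<in> herm"
    and \<eta>: "\<And>t. t \<in> {c..d} \<Longrightarrow> (\<eta> has_vector_derivative \<eta> t \<odot> k) (at t within {c..d})"
    using geodesicE[OF geo \<kappa>] by blast
  let ?r = "msqrt p"
  let ?q = "inv ?r"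
  define z where "z = ?r \<odot> k \<odot> ?q"
  have bl: "bounded_linear (\<lambda>x. ?q \<odot> x \<odot> ?q)"
    using bounded_linear_compose[OF mul.bounded_linear_left mul.bounded_linear_right] .
  have rr: "?r \<odot> (?r \<odot> x) = p \<odot> x" for x
    using msqrt_square[OF p] by (simp flip: mult_assoc)
  have "?q \<odot> (?r \<odot> ?r) = ?r"
    by (rule inv_mult_cancel[OF msqrt_invertible])
  then have "?q \<odot> p = ?r"
    by (simp only: msqrt_square[OF p])
  then have z_eq: "z = ?q \<odot> (\<eta> c \<odot> k) \<odot> ?q"
    by (simp add: z_def ends mult_assoc[symmetric])
  have z: "z \<in> herm"
    unfolding z_eq by (intro herm_sandwich k herm_inv msqrt_invertible pos_herm msqrt_pos p)
  have "((\<lambda>t. ?q \<odot> \<eta> t \<odot> ?q) has_vector_derivative (?q \<odot> \<eta> t \<odot> ?q) \<odot> z) (at t within {c..d})"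
    if "t \<in> {c..d}" for t
    using bounded_linear.has_vector_derivative[OF bl \<eta>[OF that]]
    by (simp add: z_def mult_assoc inv_simps msqrt_invertible)
  then have "?q \<odot> \<eta> t \<odot> ?q = (?q \<odot> \<eta> c \<odot> ?q) \<odot> expo ((t - c) *\<^sub>R z)" if "t \<in> {c..d}" for t
    by (rule linear_ode_unique[OF _ that])
  moreover have "?q \<odot> \<eta> c \<odot> ?q = \<one>"
    using \<open>?q \<odot> p = ?r\<close> by (simp add: ends inv_simps msqrt_invertible)
  ultimately have sol: "?q \<odot> \<eta> t \<odot> ?q = expo ((t - c) *\<^sub>R z)" if "t \<in> {c..d}" for t
    using that by simp
  have "expo ((d - c) *\<^sub>R z) = expo s"
    using sol[of d] cd by (simp add: ends geodesic_path_def mult_assoc inv_simps msqrt_invertible)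
  then have zs: "(d - c) *\<^sub>R z = s"
    by (rule expo_inj_on_herm[OF herm_scaleR[OF z] s])
  have "\<eta> t = geodesic_path p s (1 / (d - c) * t + - c / (d - c))" if "t \<in> {c..d}" for t
  proof -
    have "1 / (d - c) * t + - c / (d - c) = (t - c) / (d - c)"
      by (simp add: diff_divide_distrib)
    then have "(1 / (d - c) * t + - c / (d - c)) *\<^sub>R s = (t - c) *\<^sub>R z"
      using cd by (simp only: zs[symmetric]) simp
    then have "geodesic_path p s (1 / (d - c) * t + - c / (d - c)) = ?r \<odot> (?q \<odot> \<eta> t \<odot> ?q) \<odot> ?r"
      using sol[OF that] by (simp add: geodesic_path_def)
    then show ?thesis
      by (simp add: mult_assoc inv_simps msqrt_invertible)
  qed
  then show ?thesis
    unfolding affine_reparametrization_def using cd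
    by (intro exI[of _ "1 / (d - c)"] exI[of _ "- c / (d - c)"])
      (simp add: diff_divide_distrib[symmetric])
qed

end

definition gmean :: "'a \<Rightarrow> 'a \<Rightarrow> 'a" where
  "gmean p q = msqrt p \<odot> msqrt (inv (msqrt p) \<odot> q \<odot> inv (msqrt p)) \<odot> msqrt p"

text \<open>The geodesic reaches \<open>q\<close> at time 1 for \<open>s = log (p\<^bsup>-1/2\<^esup> q p\<^bsup>-1/2\<^esup>)\<close>; half of this logarithm yields the square root in the
geometric mean.\<close>

theorem gmean_midpoint:
  assumes p: "p \<in> pos" and q: "q \<in> pos" and \<kappa>: "0 < \<kappa>"
  obtains \<gamma> where "geodesic pos herm (metric \<kappa>) 0 1 \<gamma>" "\<gamma> 0 = p" "\<gamma> 1 = q"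
    "\<And>c d \<eta>. geodesic pos herm (metric \<kappa>) c d \<eta> \<Longrightarrow> \<eta> c = p \<Longrightarrow> \<eta> d = q \<Longrightarrow>
      affine_reparametrization 0 1 \<gamma> c d \<eta>"
    "\<And>m. curve_midpoint (metric \<kappa>) 0 1 \<gamma> m \<longleftrightarrow> m = gmean p q"
proof -
  let ?r = "msqrt p"
  have r: "invertible ?r" "?r \<in> herm"
    using p by (auto intro: pos_invertible msqrt_pos pos_herm)
  have "inv ?r \<odot> q \<odot> inv ?r \<in> pos"
    by (intro pos_congruence q herm_inv invertible_inv r)
  then obtain s where s: "s \<in> herm" "expo s = inv ?r \<odot> q \<odot> inv ?r"
    using expo_surj_pos by blast
  have q1: "geodesic_path p s 1 = q"
    using s r by (simp add: geodesic_path_def mult_assoc inv_simps)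
  have "gmean p q = geodesic_path p s (1 / 2)"
    by (simp add: gmean_def geodesic_path_def s(2)[symmetric] msqrt_expo s(1))
  then have "curve_midpoint (metric \<kappa>) 0 1 (geodesic_path p s) m \<longleftrightarrow> m = gmean p q" for m
    using curve_midpoint_geodesic_path[OF p s(1) \<kappa>] by simp
  then show ?thesis
    using geodesic_geodesic_path[OF p s(1), of 0 1] geodesic_path_0[OF p s(1)] q1
      geodesic_unique[OF p s(1) \<kappa>]
    by (intro that[of "geodesic_path p s"]) simp_all
qed

end

section \<open>The algebra of tensors under the T-product\<close>

text \<open>The slice positions form a copy of the integers modulo \<open>p\<close>: \<open>slice_at\<close> is the reduction, \<open>slice_pos\<close> the choice of
representatives in \<open>{0..<p}\<close>.\<close>

lemma slice_pos_range: "0 \<le> slice_pos (k::'p::{finite,linorder})" "slice_pos k < int CARD('p)"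
proof -
  have "card {..<k} < CARD('p)"
    by (rule psubset_card_mono) auto
  then show "0 \<le> slice_pos k" "slice_pos k < int CARD('p)"
    by (simp_all add: slice_pos_def)
qed

lemma slice_pos_slice_at: "slice_pos (slice_at i :: 'p::{finite,linorder}) = i mod int CARD('p)"
proof -
  let ?xs = "sorted_list_of_set (UNIV :: 'p set)"
  let ?n = "nat (i mod int CARD('p))"
  have n: "?n < length ?xs"
    by (simp add: nat_less_iff)
  have "{..<?xs ! ?n} = (!) ?xs ` {..<?n}"
  proof (intro set_eqI iffI)
    fix x assume "x \<in> {..<?xs ! ?n}"
    moreover obtain m where m: "m < length ?xs" "x = ?xs ! m"
      by (metis UNIV_I finite in_set_conv_nth set_sorted_list_of_set)
    ultimately have "m < ?n"
      using sorted_nth_mono[OF sorted_sorted_list_of_set, of ?n m UNIV] by (force simp: not_less)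
    then show "x \<in> (!) ?xs ` {..<?n}"
      using m by auto
  next
    fix x assume "x \<in> (!) ?xs ` {..<?n}"
    then show "x \<in> {..<?xs ! ?n}"
      using n strict_sorted_list_of_set[of "UNIV :: 'p set"]
      by (auto simp: sorted_wrt_nth_less)
  qed
  moreover have "inj_on ((!) ?xs) {..<?n}"
    using n by (intro inj_on_nth) auto
  ultimately have "card {..<?xs ! ?n} = ?n"
    by (simp add: card_image)
  then show ?thesis
    by (simp add: slice_pos_def slice_at_def)
qed

lemma inj_slice_pos: "inj (slice_pos :: 'p::{finite,linorder} \<Rightarrow> int)"
proof (rule linorder_injI)
  fix k l :: 'p assume "k < l"
  then have "card {..<k} < card {..<l}"
    by (intro psubset_card_mono) auto
  then show "slice_pos k \<noteq> slice_pos l"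
    by (simp add: slice_pos_def)
qed

lemma slice_at_slice_pos [simp]: "slice_at (slice_pos k) = k"
  using slice_pos_range[of k] by (auto intro: injD[OF inj_slice_pos] simp: slice_pos_slice_at)

lemma slice_at_cong:
  "i mod int CARD('p) = j mod int CARD('p) \<Longrightarrow> (slice_at i :: 'p::{finite,linorder}) = slice_at j"
  by (simp add: slice_at_def)

lemma slice_at_slice_pos_slice_at [simp]:
  fixes j :: int
  defines "l \<equiv> slice_at j :: 'p::{finite,linorder}"
  shows "(slice_at (i - slice_pos l) :: 'p) = slice_at (i - j)"
    and "(slice_at (slice_pos l - i) :: 'p) = slice_at (j - i)"
    and "(slice_at (slice_pos l + i) :: 'p) = slice_at (j + i)"
    and "(slice_at (- slice_pos l) :: 'p) = slice_at (- j)"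
  unfolding l_def by (rule slice_at_cong, simp add: slice_pos_slice_at mod_simps)+

lemma sum_slice_shift:
  fixes f :: "'p::{finite,linorder} \<Rightarrow> 'a::comm_monoid_add"
  shows "(\<Sum>k\<in>UNIV. f (slice_at (slice_pos (k::'p) - i))) = (\<Sum>k\<in>UNIV. f k)"
  by (rule sum.reindex_bij_witness[where i = "\<lambda>k. slice_at (slice_pos k + i)"
        and j = "\<lambda>k. slice_at (slice_pos k - i)"]) auto

lemma sum_slice_reflect:
  fixes f :: "'p::{finite,linorder} \<Rightarrow> 'a::comm_monoid_add"
  shows "(\<Sum>k\<in>UNIV. f (slice_at (- slice_pos (k::'p)))) = (\<Sum>k\<in>UNIV. f k)"
  by (rule sum.reindex_bij_witness[where i = "\<lambda>k. slice_at (- slice_pos k)"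
        and j = "\<lambda>k. slice_at (- slice_pos k)"]) auto

lemma bcirc_nth: "bcirc \<A> $ (k, i) $ (l, j) = \<A> $ slice_at (slice_pos k - slice_pos l) $ i $ j"
  by (simp add: bcirc_def)

lemma sum_UNIV_prod: "(\<Sum>x\<in>UNIV. f x) = (\<Sum>k\<in>UNIV. \<Sum>i\<in>UNIV. f (k, i))"
  unfolding UNIV_Times_UNIV[symmetric] by (simp add: sum.cartesian_product)

lemma t_prod_nth:
  "(\<A> \<star> \<B>) $ k $ i $ j =
    (\<Sum>l\<in>UNIV. \<Sum>h\<in>UNIV. \<A> $ slice_at (slice_pos k - slice_pos l) $ i $ h * \<B> $ l $ h $ j)"
  by (simp add: t_prod_def t_fold_def t_unfold_def matrix_matrix_mult_def bcirc_nth sum_UNIV_prod)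

lemma t_fold_unfold [simp]: "t_fold (t_unfold \<A>) = \<A>" "t_unfold (t_fold M) = M"
  by (simp_all add: t_fold_def t_unfold_def vec_eq_iff)

lemma t_unfold_prod: "t_unfold (\<A> \<star> \<B>) = bcirc \<A> ** t_unfold \<B>"
  by (simp add: t_prod_def)

text \<open>In block \<open>(k, m)\<close> the left side sums over \<open>l\<close> with \<open>\<B>\<close> in position \<open>l\<close>, the right side with \<open>\<B>\<close> in position \<open>l - m\<close>: a cyclic shift of
the summation index.\<close>

lemma bcirc_prod:
  fixes \<A> :: "('m::finite, 'n::finite, 'p::{finite,linorder}) tensor" and \<B> :: "('n, 's::finite, 'p) tensor"
  shows "bcirc (\<A> \<star> \<B>) = bcirc \<A> ** bcirc \<B>"
proof -
  have "bcirc (\<A> \<star> \<B>) $ (k, i) $ (m, j) = (bcirc \<A> ** bcirc \<B>) $ (k, i) $ (m, j)"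
    for k m :: 'p and i j
  proof -
    let ?f = "\<lambda>l::'p. \<Sum>h\<in>UNIV. \<A> $ slice_at (slice_pos k - slice_pos m - slice_pos l) $ i $ h * \<B> $ l $ h $ j"
    have "bcirc (\<A> \<star> \<B>) $ (k, i) $ (m, j) = (\<Sum>l\<in>UNIV. ?f l)"
      by (simp add: bcirc_nth t_prod_nth)
    also have "\<dots> = (\<Sum>l\<in>UNIV. ?f (slice_at (slice_pos (l::'p) - slice_pos m)))"
      by (rule sum_slice_shift[of ?f "slice_pos m", symmetric])
    also have "\<dots> = (bcirc \<A> ** bcirc \<B>) $ (k, i) $ (m, j)"
      by (simp add: matrix_matrix_mult_def bcirc_nth sum_UNIV_prod)
    finally show ?thesis .
  qed
  then show ?thesis
    by (simp add: vec_eq_iff)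
qed

lemma t_prod_assoc: "(\<A> \<star> \<B>) \<star> \<C> = \<A> \<star> (\<B> \<star> \<C>)"
  by (simp add: t_prod_def[of "\<A> \<star> \<B>"] t_prod_def[of \<A> "\<B> \<star> \<C>"] bcirc_prod t_unfold_prod matrix_mul_assoc)

text \<open>The first block column of \<open>bcirc \<A>\<close> lists the slices of \<open>\<A>\<close>.\<close>

lemma bcirc_inject:
  fixes \<A> \<B> :: "('m::finite, 'n::finite, 'p::{finite,linorder}) tensor"
  assumes eq: "bcirc \<A> = bcirc \<B>"
  shows "\<A> = \<B>"
proof -
  have "bcirc \<A> $ (k, i) $ (slice_at 0, j) = bcirc \<B> $ (k, i) $ (slice_at 0, j)" for k i j
    by (simp add: eq)
  then show ?thesis
    by (simp add: vec_eq_iff bcirc_nth)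
qed

lemma slice_at_eq_iff: "(slice_at i :: 'p::{finite,linorder}) = slice_at j \<longleftrightarrow> i mod int CARD('p) = j mod int CARD('p)"
  by (metis slice_at_cong slice_pos_slice_at)

lemma slice_at_diff_eq_0 [simp]: "(slice_at (slice_pos k - slice_pos l) = (slice_at 0 :: 'p)) \<longleftrightarrow> k = (l :: 'p::{finite,linorder})"
proof -
  have "(slice_pos k - slice_pos l) mod int CARD('p) = 0 \<longleftrightarrow> slice_pos k mod int CARD('p) = slice_pos l mod int CARD('p)"
    by (metis mod_eq_dvd_iff mod_eq_0_iff_dvd)
  then show ?thesis
    using slice_pos_range[of k] slice_pos_range[of l] by (simp add: slice_at_eq_iff inj_eq[OF inj_slice_pos])
qed

lemma bcirc_t_id: "bcirc t_id = mat 1"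
  by (auto simp: vec_eq_iff bcirc_nth t_id_def mat_def)

lemma t_id_left: "t_id \<star> \<A> = \<A>"
  by (simp add: t_prod_def bcirc_t_id)

lemma t_id_right: "\<A> \<star> t_id = \<A>"
  by (rule bcirc_inject) (simp add: bcirc_prod bcirc_t_id)

lemma bcirc_t_adjoint: "bcirc (t_adjoint \<A>) $ r $ c = cnj (bcirc \<A> $ c $ r)"
  by (cases r, cases c) (simp add: bcirc_nth t_adjoint_def)

lemma t_adjoint_adjoint: "t_adjoint (t_adjoint \<A>) = \<A>"
  by (rule bcirc_inject) (simp add: vec_eq_iff bcirc_t_adjoint)

lemma t_adjoint_prod: "t_adjoint (\<A> \<star> \<B>) = t_adjoint \<B> \<star> t_adjoint \<A>"
  by (rule bcirc_inject)
    (simp add: vec_eq_iff bcirc_t_adjoint bcirc_prod matrix_matrix_mult_def mult.commute)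

lemma t_inner_eq: "t_inner \<A> \<B> = (\<Sum>r\<in>UNIV. \<Sum>j\<in>UNIV. cnj (t_unfold \<A> $ r $ j) * t_unfold \<B> $ r $ j)"
proof -
  have "t_inner \<A> \<B> = (\<Sum>i\<in>UNIV. \<Sum>k\<in>UNIV. \<Sum>j\<in>UNIV. cnj (\<A> $ k $ i $ j) * \<B> $ k $ i $ j)"
    unfolding t_inner_def by (intro sum.cong refl sum.swap)
  also have "\<dots> = (\<Sum>k\<in>UNIV. \<Sum>i\<in>UNIV. \<Sum>j\<in>UNIV. cnj (\<A> $ k $ i $ j) * \<B> $ k $ i $ j)"
    by (rule sum.swap)
  finally show ?thesis
    by (simp add: sum_UNIV_prod t_unfold_def)
qed

lemma Re_t_inner: "Re (t_inner \<A> \<B>) = \<A> \<bullet> \<B>"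
  by (simp add: t_inner_eq sum_UNIV_prod t_unfold_def inner_vec_def inner_complex_def)

lemma t_inner_prod_left: "t_inner (\<A> \<star> \<X>) \<Y> = t_inner \<X> (t_adjoint \<A> \<star> \<Y>)"
proof -
  let ?f = "\<lambda>r j c. cnj (bcirc \<A> $ r $ c) * cnj (t_unfold \<X> $ c $ j) * t_unfold \<Y> $ r $ j"
  have "t_inner (\<A> \<star> \<X>) \<Y> = (\<Sum>r\<in>UNIV. \<Sum>j\<in>UNIV. \<Sum>c\<in>UNIV. ?f r j c)"
    by (simp add: t_inner_eq t_unfold_prod matrix_matrix_mult_def sum_distrib_right)
  also have "\<dots> = (\<Sum>j\<in>UNIV. \<Sum>r\<in>UNIV. \<Sum>c\<in>UNIV. ?f r j c)"
    by (rule sum.swap)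
  also have "\<dots> = (\<Sum>j\<in>UNIV. \<Sum>c\<in>UNIV. \<Sum>r\<in>UNIV. ?f r j c)"
    by (intro sum.cong refl sum.swap)
  also have "\<dots> = (\<Sum>c\<in>UNIV. \<Sum>j\<in>UNIV. \<Sum>r\<in>UNIV. ?f r j c)"
    by (rule sum.swap)
  also have "\<dots> = t_inner \<X> (t_adjoint \<A> \<star> \<Y>)"
    by (simp add: t_inner_eq t_unfold_prod matrix_matrix_mult_def sum_distrib_left bcirc_t_adjoint mult_ac)
  finally show ?thesis .
qed

lemma t_inner_commute: "t_inner \<Y> \<X> = cnj (t_inner \<X> \<Y>)"
  by (simp add: t_inner_def mult.commute)

lemma t_adjoint_isometry:
  fixes \<A> \<B> :: "('m::finite, 'n::finite, 'p::{finite,linorder}) tensor"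
  shows "t_adjoint \<A> \<bullet> t_adjoint \<B> = \<A> \<bullet> \<B>"
proof -
  have "t_adjoint \<A> \<bullet> t_adjoint \<B> = (\<Sum>k\<in>(UNIV::'p set). \<Sum>i\<in>UNIV. \<Sum>j\<in>UNIV.
      \<A> $ slice_at (- slice_pos k) $ j $ i \<bullet> \<B> $ slice_at (- slice_pos k) $ j $ i)"
    by (simp add: inner_vec_def t_adjoint_def inner_complex_def)
  also have "\<dots> = (\<Sum>k\<in>UNIV. \<Sum>i\<in>UNIV. \<Sum>j\<in>UNIV. \<A> $ k $ j $ i \<bullet> \<B> $ k $ j $ i)"
    by (rule sum_slice_reflect)
  also have "\<dots> = \<A> \<bullet> \<B>"
    unfolding inner_vec_def by (intro sum.cong refl sum.swap)
  finally show ?thesis .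
qed

text \<open>Positivity is tested on single columns, whereas an algebra element of the same size as \<open>\<A>\<close> has \<open>n\<close> columns, on which
\<open>\<A>\<close> acts separately.  The form of a square tensor is the sum of the forms of its columns; conversely a column is
tested by repeating it \<open>n\<close> times.\<close>

lemma t_pd_iff:
  fixes \<A> :: "('n::finite, 'n, 'p::{finite,linorder}) tensor"
  shows "\<A> \<in> t_pd \<longleftrightarrow> t_adjoint \<A> = \<A> \<and> (\<forall>\<Y> :: ('n, 'n, 'p) tensor. \<Y> \<noteq> 0 \<longrightarrow> 0 < \<Y> \<bullet> (\<A> \<star> \<Y>))"
proof -
  define col :: "('n, 'n, 'p) tensor \<Rightarrow> 'n \<Rightarrow> ('n, 1, 'p) tensor"
    where "col \<Y> j = (\<chi> k i _. \<Y> $ k $ i $ j)" for \<Y> j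
  have col_prod: "\<A> \<star> col \<Y> j = col (\<A> \<star> \<Y>) j" for \<Y> j
    by (simp add: vec_eq_iff t_prod_nth col_def)
  have inner_col: "\<Y> \<bullet> \<Z> = (\<Sum>j\<in>UNIV. col \<Y> j \<bullet> col \<Z> j)" for \<Y> \<Z>
  proof -
    have "\<Y> \<bullet> \<Z> = (\<Sum>k\<in>UNIV. \<Sum>j\<in>UNIV. \<Sum>i\<in>UNIV. \<Y> $ k $ i $ j \<bullet> \<Z> $ k $ i $ j)"
      unfolding inner_vec_def by (intro sum.cong refl sum.swap)
    also have "\<dots> = (\<Sum>j\<in>UNIV. \<Sum>k\<in>UNIV. \<Sum>i\<in>UNIV. \<Y> $ k $ i $ j \<bullet> \<Z> $ k $ i $ j)"
      by (rule sum.swap)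
    finally show ?thesis
      by (simp add: inner_vec_def col_def)
  qed
  show ?thesis
  proof (intro iffI conjI allI impI)
    assume A: "\<A> \<in> t_pd"
    then show "t_adjoint \<A> = \<A>"
      by (simp add: t_pd_def t_herm_def)
    have pos: "0 < \<X> \<bullet> (\<A> \<star> \<X>)" if "\<X> \<noteq> 0" for \<X> :: "('n, 1, 'p) tensor"
      using A that by (auto simp: t_pd_def Re_t_inner)
    fix \<Y> :: "('n, 'n, 'p) tensor" assume "\<Y> \<noteq> 0"
    then obtain j where j: "col \<Y> j \<noteq> 0"
      by (auto simp: col_def vec_eq_iff)
    have "0 \<le> \<X> \<bullet> (\<A> \<star> \<X>)" for \<X> :: "('n, 1, 'p) tensor"
      using pos[of \<X>] by (cases "\<X> = 0") auto
    then have "0 < (\<Sum>j\<in>UNIV. col \<Y> j \<bullet> (\<A> \<star> col \<Y> j))"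
      using pos[OF j] by (intro sum_pos2[of _ j]) auto
    then show "0 < \<Y> \<bullet> (\<A> \<star> \<Y>)"
      by (simp add: inner_col col_prod)
  next
    assume A: "t_adjoint \<A> = \<A> \<and> (\<forall>\<Y> :: ('n, 'n, 'p) tensor. \<Y> \<noteq> 0 \<longrightarrow> 0 < \<Y> \<bullet> (\<A> \<star> \<Y>))"
    have "t_inner \<X> (\<A> \<star> \<X>) \<in> \<real> \<and> 0 < Re (t_inner \<X> (\<A> \<star> \<X>))" if "\<X> \<noteq> 0"
      for \<X> :: "('n, 1, 'p) tensor"
    proof
      have "cnj (t_inner \<X> (\<A> \<star> \<X>)) = t_inner \<X> (\<A> \<star> \<X>)"
        using A t_inner_prod_left[of \<A> \<X> \<X>] by (simp flip: t_inner_commute)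
      then show "t_inner \<X> (\<A> \<star> \<X>) \<in> \<real>"
        by (simp add: complex_is_Real_iff complex_eq_iff)
      define \<Y> :: "('n, 'n, 'p) tensor" where "\<Y> = (\<chi> k i j. \<X> $ k $ i $ 1)"
      have col_Y: "col \<Y> j = \<X>" for j
        by (auto simp: col_def \<Y>_def vec_eq_iff)
      have "\<Y> \<noteq> 0"
        using that by (auto simp: \<Y>_def vec_eq_iff)
      then have "0 < \<Y> \<bullet> (\<A> \<star> \<Y>)"
        using A by blast
      also have "\<dots> = real CARD('n) * (\<X> \<bullet> (\<A> \<star> \<X>))"
        by (simp add: inner_col col_Y flip: col_prod)
      finally show "0 < Re (t_inner \<X> (\<A> \<star> \<X>))"
        by (simp add: Re_t_inner zero_less_mult_iff)
    qed
    then show "\<A> \<in> t_pd"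
      using A by (simp add: t_pd_def t_herm_def)
  qed
qed

text \<open>All \<open>p\<close> diagonal blocks of \<open>bcirc \<A>\<close> are the first frontal slice of \<open>\<A>\<close>.\<close>

lemma t_trace_eq:
  fixes \<A> :: "('n::finite, 'n, 'p::{finite,linorder}) tensor"
  shows "Re (t_trace \<A>) = real CARD('p) * (t_id \<bullet> \<A>)"
proof -
  have "t_trace \<A> = of_nat CARD('p) * (\<Sum>i\<in>UNIV. \<A> $ slice_at 0 $ i $ i)"
    by (simp add: t_trace_def trace_def sum_UNIV_prod bcirc_nth)
  moreover have "t_id \<bullet> \<A> = (\<Sum>i\<in>UNIV. Re (\<A> $ slice_at 0 $ i $ i))"
  proof -
    have "t_id \<bullet> \<A> = (\<Sum>k\<in>UNIV. if k = slice_at 0 then mat 1 \<bullet> \<A> $ k else 0)"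
      unfolding inner_vec_def[of t_id] by (intro sum.cong) (auto simp: t_id_def)
    also have "\<dots> = mat 1 \<bullet> \<A> $ slice_at 0"
      by simp
    also have "\<dots> = (\<Sum>i\<in>UNIV. \<Sum>j\<in>UNIV. if j = i then Re (\<A> $ slice_at 0 $ i $ j) else 0)"
      unfolding inner_vec_def by (intro sum.cong refl) (auto simp: mat_def inner_complex_def)
    finally show ?thesis
      by simp
  qed
  ultimately show ?thesis
    by simp
qed

lemma bounded_bilinear_t_prod:
  "bounded_bilinear ((\<star>) :: ('n::finite, 'n, 'p::{finite,linorder}) tensor \<Rightarrow> _)"
proof (rule bilinear_conv_bounded_bilinear[THEN iffD1])
  show "bilinear ((\<star>) :: ('n, 'n, 'p) tensor \<Rightarrow> _)"
    unfolding bilinear_def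
    by (intro allI conjI linearI)
      (simp_all add: vec_eq_iff t_prod_nth algebra_simps sum.distrib scaleR_sum_right)
qed

lemma bounded_linear_t_adjoint:
  "bounded_linear (t_adjoint :: ('n::finite, 'n, 'p::{finite,linorder}) tensor \<Rightarrow> _)"
  by (intro linear_conv_bounded_linear[THEN iffD1] linearI) (simp_all add: vec_eq_iff t_adjoint_def)

interpretation tensor: star_algebra "(\<star>) :: ('n::finite, 'n, 'p::{finite,linorder}) tensor \<Rightarrow> _" t_id t_adjoint
proof (rule star_algebra.intro)
  show "(\<X> \<star> \<Y>) \<bullet> \<Z> = \<Y> \<bullet> (t_adjoint \<X> \<star> \<Z>)" for \<X> \<Y> \<Z> :: "('n, 'n, 'p) tensor"
    by (simp add: t_inner_prod_left flip: Re_t_inner)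
qed (simp_all add: bounded_bilinear_t_prod t_prod_assoc t_id_left t_id_right bounded_linear_t_adjoint
    t_adjoint_adjoint t_adjoint_prod t_adjoint_isometry)

lemma tensor_herm: "tensor.herm = t_herm"
  by (simp add: tensor.herm_def t_herm_def)

lemma tensor_pos: "tensor.pos = t_pd"
  by (auto simp: tensor.pos_def tensor.herm_def t_pd_iff)

lemma tensor_inv: "tensor.inv = t_inv"
  by (simp add: fun_eq_iff tensor.inv_def t_inv_def)

lemma tensor_gmean: "tensor.gmean = (\<sharp>)"
  by (simp add: fun_eq_iff tensor.gmean_def t_gmean_def tensor_inv tensor.msqrt_def t_sqrt_def tensor_pos)

lemma tensor_metric:
  "tensor.metric (real CARD('p)) = (t_metric :: ('n::finite, 'n, 'p::{finite,linorder}) tensor \<Rightarrow> _)"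
  by (simp add: fun_eq_iff tensor.metric_def t_metric_def tensor.tr_def t_trace_eq tensor_inv)

theorem corollary4p2:
  fixes \<A> \<B> :: "('n::finite, 'n, 'p::{finite,linorder}) tensor"
  assumes "\<A> \<in> t_pd" and "\<B> \<in> t_pd"
  shows "\<exists>a b \<gamma>. t_geodesic_between \<A> \<B> a b \<gamma> \<and>
           (\<forall>c d \<eta>. t_geodesic_between \<A> \<B> c d \<eta> \<longrightarrow> affine_reparametrization a b \<gamma> c d \<eta>) \<and>
           (\<forall>\<M>. curve_midpoint t_metric a b \<gamma> \<M> \<longleftrightarrow> \<M> = \<A> \<sharp> \<B>)"
proof -
  have "0 < real CARD('p)"
    by simp
  from tensor.gmean_midpoint[OF assms[folded tensor_pos] this]
  obtain \<gamma> where "t_geodesic_between \<A> \<B> 0 1 \<gamma>"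
    and "\<And>c d \<eta>. t_geodesic_between \<A> \<B> c d \<eta> \<Longrightarrow> affine_reparametrization 0 1 \<gamma> c d \<eta>"
    and "\<And>\<M>. curve_midpoint t_metric 0 1 \<gamma> \<M> \<longleftrightarrow> \<M> = \<A> \<sharp> \<B>"
    unfolding tensor_pos tensor_herm tensor_metric tensor_gmean t_geodesic_between_def by metis
  then show ?thesis
    by blast
qed

end
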